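(* Fix a parity for framed 4-graphs with one unicursal component (for example, the Gaussian parity). For a framed 4-graph $\Gamma$ with one unicursal component set $$[\Gamma]=\sum_{s}\Gamma_s\in\mathbb{Z}_2\mathfrak{G},$$ where the sum is over all choices $s$ of one of the two smoothings at each even vertex of $\Gamma$ (odd vertices are not smoothed) for which the resulting framed 4-graph $\Gamma_s$ has exactly one unicursal component. If $\Gamma$ and $\Gamma'$ represent the same free knot, then $[\Gamma]=[\Gamma']$ in $\mathbb{Z}_2\mathfrak{G}$.
   Context: A framed 4-graph is a finite 4-valent graph (loops and multiple edges allowed, as well as components homeomorphic to a circle without vertices) in which at each vertex the four emanating half-edges are split into two pairs, called pairs of (formally) opposite half-edges. Isomorphisms respect the framing. Passing at each vertex from a half-edge to the opposite one decomposes the graph into unicursal components. Reidemeister moves. (1) Addition/removal of a vertex carrying a loop whose two half-edges are non-opposite at that vertex (on removal the other two half-edges are merged into one edge). (2) Addition/removal of a bigon: two vertices $u,v$ joined by two edges that are non-opposite both at $u$ and at $v$; on removal $u,v$ disappear and, for each of the two bigon edges $e$, the half-edge opposite to $e$ at $u$ is joined with the half-edge opposite to $e$ at $v$. (3) Three vertices pairwise joined by the edges of a triangle, the two triangle edges being non-opposite at each of the three vertices; the move pulls one strand through the crossing of the other two, i.e. each of the three strands passes its two crossings in the opposite order. A free link is an equivalence class of framed 4-graphs modulo these moves; a free knot is a free link with one unicursal component. A framed 4-graph with one unicursal component is encoded by its chord (Gauss) diagram: a circle traversing the unicursal component, with one chord per vertex joining the two preimages of the vertex. Two chords are linked if the ends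 of one lie in different components of the circle minus the ends of the other. A parity is a rule declaring every vertex of every framed 4-graph with one unicursal component even or odd (invariantly under framed isomorphisms) such that: the vertex added/removed by a first Reidemeister move is even; the two vertices added/removed by a second move have the same parity; among the three vertices participating in a third move the number of odd ones is even, and each of these three vertices has the same parity before and after the move; vertices not participating in a move keep their parity. The Gaussian parity declares a vertex even if its chord is linked with an even number of other chords, and odd otherwise. Smoothing at a vertex $v$ with half-edges $a,b,c,d$, where $a$ is opposite to $c$ and $b$ is opposite to $d$: remove $v$ and reconnect either $a$ with $b$ and $c$ with $d$, or $a$ with $d$ and $b$ with $c$; the rest of the graph with its framing is unchanged. $\mathfrak{G}$ is the set of equivalence classes of framed 4-graphs with one unicursal component modulo second Reidemeister moves only, and $\mathbb{Z}_2\mathfrak{G}$ is the $\mathbb{Z}_2$-vector space of finite formal linear combinations of elements of $\mathfrak{G}$. *)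

theory Defs
  imports
    "HOL-Library.Z2"
    "HOL-Library.Poly_Mapping"
    "HOL-Combinatorics.Transposition"
begin

text \<open>
  A framed 4-graph is given by its half-edges: \<open>vert\<close> sends a half-edge to its vertex, \<open>opp\<close> to
  the formally opposite half-edge at that vertex (this is the framing), and \<open>join\<close> to the other
  half of its edge. Components without vertices have no half-edges and are only counted, by
  \<open>circles\<close>. Half-edges and vertices are labelled by natural numbers, so every finite graph
  occurs up to isomorphism. The values of \<open>vert\<close>, \<open>opp\<close> and \<open>join\<close> outside \<open>halves\<close> are
  irrelevant: \<open>framed_iso\<close> below ignores them.
\<close>

record framed_graph =
  halves :: "nat set"
  vert :: "nat \<Rightarrow> nat"
  opp :: "nat \<Rightarrow> nat"
  join :: "nat \<Rightarrow> nat"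
  circles :: nat

definition verts :: "framed_graph \<Rightarrow> nat set" where
  "verts G = vert G ` halves G"

definition halves_at :: "framed_graph \<Rightarrow> nat set \<Rightarrow> nat set" where
  "halves_at G W = {h \<in> halves G. vert G h \<in> W}"

definition framed_4_graph :: "framed_graph \<Rightarrow> bool" where
  "framed_4_graph G \<longleftrightarrow>
     finite (halves G) \<and>
     (\<forall>v\<in>verts G. card (halves_at G {v}) = 4) \<and>
     (\<forall>h\<in>halves G. opp G h \<in> halves G \<and> opp G h \<noteq> h \<and> opp G (opp G h) = h \<and>
        vert G (opp G h) = vert G h) \<and>
     (\<forall>h\<in>halves G. join G h \<in> halves G \<and> join G h \<noteq> h \<and> join G (join G h) = h)"

definition framed_iso ::
  "framed_graph \<Rightarrow> framed_graph \<Rightarrow> (nat \<Rightarrow> nat) \<Rightarrow> (nat \<Rightarrow> nat) \<Rightarrow> bool" where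
  "framed_iso G G' f g \<longleftrightarrow>
     bij_betw f (halves G) (halves G') \<and> bij_betw g (verts G) (verts G') \<and>
     (\<forall>h\<in>halves G. vert G' (f h) = g (vert G h) \<and> opp G' (f h) = f (opp G h) \<and>
        join G' (f h) = f (join G h)) \<and>
     circles G' = circles G"

text \<open>
  The paths obtained from the edges when each half-edge \<open>h \<in> R\<close> is glued to \<open>\<sigma> h\<close>. In the uses
  below \<open>join G\<close> and \<open>\<sigma>\<close> are involutions, so this relation is symmetric.
\<close>

definition path_rel :: "framed_graph \<Rightarrow> nat set \<Rightarrow> (nat \<Rightarrow> nat) \<Rightarrow> (nat \<times> nat) set" where
  "path_rel G R \<sigma> = ({(h, join G h) | h. h \<in> halves G} \<union> {(h, \<sigma> h) | h. h \<in> R})\<^sup>*"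

definition num_unicursal :: "framed_graph \<Rightarrow> nat" where
  "num_unicursal G = card (halves G // path_rel G (halves G) (opp G)) + circles G"

definition framed_knot_graph :: "framed_graph \<Rightarrow> bool" where
  "framed_knot_graph G \<longleftrightarrow> framed_4_graph G \<and> num_unicursal G = 1"

text \<open>
  Remove the half-edges in \<open>R\<close>, all half-edges at some set of vertices, after gluing them in pairs
  by the fixed-point-free involution \<open>\<sigma>\<close> of \<open>R\<close>. A path running through \<open>R\<close> between two surviving
  half-edges becomes an edge; a path closing up inside \<open>R\<close> becomes a circle component.
\<close>

definition splice :: "framed_graph \<Rightarrow> nat set \<Rightarrow> (nat \<Rightarrow> nat) \<Rightarrow> framed_graph" where
  "splice G R \<sigma> = G\<lparr>
     halves := halves G - R,
     join := (\<lambda>h. THE k. k \<in> halves G - R \<and> k \<noteq> h \<and> (h, k) \<in> path_rel G R \<sigma>),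
     circles := circles G + card {C \<in> halves G // path_rel G R \<sigma>. C \<subseteq> R}\<rparr>"

text \<open>
  Removing vertices in the first two moves is splicing along \<open>opp\<close>. For a loop with half-edges
  \<open>a\<close>, \<open>b\<close> the path \<open>opp a, a, b, opp b\<close> merges the other two half-edges of the vertex; for a bigon
  edge with half-edges \<open>a\<close>, \<open>b\<close> the path \<open>opp a, a, b, opp b\<close> joins the half-edges opposite to that
  edge at its two ends.
\<close>

definition R1_removal :: "framed_graph \<Rightarrow> nat \<Rightarrow> framed_graph \<Rightarrow> bool" where
  "R1_removal G v G' \<longleftrightarrow>
     (\<exists>a\<in>halves G. vert G a = v \<and> vert G (join G a) = v \<and> join G a \<noteq> opp G a) \<and>
     G' = splice G (halves_at G {v}) (opp G)"

definition R2_removal :: "framed_graph \<Rightarrow> nat \<Rightarrow> nat \<Rightarrow> framed_graph \<Rightarrow> bool" where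
  "R2_removal G u v G' \<longleftrightarrow>
     u \<noteq> v \<and>
     (\<exists>a\<in>halves G. \<exists>b\<in>halves G.
        vert G a = u \<and> vert G b = u \<and> a \<noteq> b \<and> b \<noteq> opp G a \<and>
        vert G (join G a) = v \<and> vert G (join G b) = v \<and> join G b \<noteq> opp G (join G a)) \<and>
     G' = splice G (halves_at G {u, v}) (opp G)"

text \<open>
  The triangle has the edges \<open>a\<^sub>1 b\<^sub>1\<close>, \<open>b\<^sub>2 c\<^sub>1\<close>, \<open>c\<^sub>2 a\<^sub>2\<close>. The strand along \<open>a\<^sub>1 b\<^sub>1\<close> enters at
  \<open>opp a\<^sub>1\<close> and leaves at \<open>opp b\<^sub>1\<close>; it meets its two crossings in the opposite order once what is
  attached to \<open>opp a\<^sub>1\<close> and what is attached to \<open>opp b\<^sub>1\<close> are interchanged, the edge \<open>a\<^sub>1 b\<^sub>1\<close> being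
  kept. Doing this for all three strands conjugates \<open>join\<close> by a product of three disjoint
  transpositions. Vertices keep their labels.
\<close>

definition R3_move :: "framed_graph \<Rightarrow> nat \<Rightarrow> nat \<Rightarrow> nat \<Rightarrow> framed_graph \<Rightarrow> bool" where
  "R3_move G u v w G' \<longleftrightarrow>
     distinct [u, v, w] \<and>
     (\<exists>a\<^sub>1 a\<^sub>2 b\<^sub>1 b\<^sub>2 c\<^sub>1 c\<^sub>2.
        {a\<^sub>1, a\<^sub>2} \<subseteq> halves_at G {u} \<and> a\<^sub>1 \<noteq> a\<^sub>2 \<and> a\<^sub>2 \<noteq> opp G a\<^sub>1 \<and>
        {b\<^sub>1, b\<^sub>2} \<subseteq> halves_at G {v} \<and> b\<^sub>1 \<noteq> b\<^sub>2 \<and> b\<^sub>2 \<noteq> opp G b\<^sub>1 \<and>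
        {c\<^sub>1, c\<^sub>2} \<subseteq> halves_at G {w} \<and> c\<^sub>1 \<noteq> c\<^sub>2 \<and> c\<^sub>2 \<noteq> opp G c\<^sub>1 \<and>
        join G a\<^sub>1 = b\<^sub>1 \<and> join G b\<^sub>2 = c\<^sub>1 \<and> join G c\<^sub>2 = a\<^sub>2 \<and>
        (let \<tau> = transpose (opp G a\<^sub>1) (opp G b\<^sub>1) \<circ> transpose (opp G b\<^sub>2) (opp G c\<^sub>1) \<circ>
                 transpose (opp G c\<^sub>2) (opp G a\<^sub>2)
         in G' = G\<lparr>join := \<tau> \<circ> join G \<circ> \<tau>\<rparr>))"

definition Reidemeister_step :: "framed_graph \<Rightarrow> framed_graph \<Rightarrow> bool" where
  "Reidemeister_step G G' \<longleftrightarrow>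
     framed_4_graph G \<and> framed_4_graph G' \<and>
     ((\<exists>f g. framed_iso G G' f g) \<or> (\<exists>v. R1_removal G v G') \<or> (\<exists>u v. R2_removal G u v G') \<or>
      (\<exists>u v w. R3_move G u v w G'))"

definition free_link_equiv :: "framed_graph \<Rightarrow> framed_graph \<Rightarrow> bool" where
  "free_link_equiv = equivclp Reidemeister_step"

text \<open>A parity \<open>P\<close> declares the vertex \<open>v\<close> of \<open>G\<close> even iff \<open>P G v\<close>.\<close>

definition parity :: "(framed_graph \<Rightarrow> nat \<Rightarrow> bool) \<Rightarrow> bool" where
  "parity P \<longleftrightarrow>
     (\<forall>G G'. framed_knot_graph G \<and> framed_knot_graph G' \<longrightarrow>
        (\<forall>f g. framed_iso G G' f g \<longrightarrow> (\<forall>x\<in>verts G. P G' (g x) = P G x)) \<and>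
        (\<forall>v. R1_removal G v G' \<longrightarrow> P G v \<and> (\<forall>x\<in>verts G'. P G' x = P G x)) \<and>
        (\<forall>u v. R2_removal G u v G' \<longrightarrow> P G u = P G v \<and> (\<forall>x\<in>verts G'. P G' x = P G x)) \<and>
        (\<forall>u v w. R3_move G u v w G' \<longrightarrow>
           even (card {x \<in> {u, v, w}. \<not> P G x}) \<and> (\<forall>x\<in>verts G. P G' x = P G x)))"

text \<open>
  A choice of one of the two smoothings at each vertex in \<open>W\<close>, given by the pairing of half-edges
  that it reconnects: \<open>a\<close> may be paired with either half-edge at its vertex other than \<open>a\<close> and
  \<open>opp a\<close>, and then the remaining two half-edges are paired with each other. Requiring the
  identity elsewhere makes \<open>\<sigma>\<close> unique for each choice.
\<close>

definition smoothing_choice :: "framed_graph \<Rightarrow> nat set \<Rightarrow> (nat \<Rightarrow> nat) \<Rightarrow> bool" where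
  "smoothing_choice G W \<sigma> \<longleftrightarrow>
     (\<forall>h\<in>halves_at G W. \<sigma> h \<in> halves G \<and> vert G (\<sigma> h) = vert G h \<and>
        \<sigma> h \<noteq> h \<and> \<sigma> h \<noteq> opp G h \<and> \<sigma> (\<sigma> h) = h) \<and>
     (\<forall>h. h \<notin> halves_at G W \<longrightarrow> \<sigma> h = h)"

definition smooth :: "framed_graph \<Rightarrow> nat set \<Rightarrow> (nat \<Rightarrow> nat) \<Rightarrow> framed_graph" where
  "smooth G W \<sigma> = splice G (halves_at G W) \<sigma>"

definition R2_step :: "framed_graph \<Rightarrow> framed_graph \<Rightarrow> bool" where
  "R2_step G G' \<longleftrightarrow>
     framed_knot_graph G \<and> framed_knot_graph G' \<and>
     ((\<exists>f g. framed_iso G G' f g) \<or> (\<exists>u v. R2_removal G u v G'))"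

definition R2_equiv :: "framed_graph \<Rightarrow> framed_graph \<Rightarrow> bool" where
  "R2_equiv G G' \<longleftrightarrow> framed_knot_graph G \<and> framed_knot_graph G' \<and> equivclp R2_step G G'"

lemma framed_knot_graph_circle:
  "framed_knot_graph \<lparr>halves = {}, vert = id, opp = id, join = id, circles = 1\<rparr>"
  by (simp add: framed_knot_graph_def framed_4_graph_def verts_def num_unicursal_def)

lemma part_equivp_R2_equiv: "part_equivp R2_equiv"
proof (rule part_equivpI)
  show "\<exists>G. R2_equiv G G"
    using framed_knot_graph_circle by (auto simp: R2_equiv_def)
  show "symp R2_equiv"
    by (auto simp: symp_def R2_equiv_def intro: equivclp_sym)
  show "transp R2_equiv"
    by (auto simp: transp_def R2_equiv_def intro: equivclp_trans)
qed

quotient_type knot_graph_mod_R2 = framed_graph / partial: R2_equiv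
  by (rule part_equivp_R2_equiv)

definition parity_bracket ::
  "(framed_graph \<Rightarrow> nat \<Rightarrow> bool) \<Rightarrow> framed_graph \<Rightarrow> knot_graph_mod_R2 \<Rightarrow>\<^sub>0 bit" where
  "parity_bracket P G =
     (let W = {v \<in> verts G. P G v} in
      \<Sum>\<sigma> | smoothing_choice G W \<sigma> \<and> num_unicursal (smooth G W \<sigma>) = 1.
        Poly_Mapping.single (abs_knot_graph_mod_R2 (smooth G W \<sigma>)) 1)"

end

theory Submission
  imports Defs "HOL-Combinatorics.Permutations"
begin

text \<open>
  Smoothing at the even vertices can be done in two stages, so it suffices to smooth the even
  vertices outside a move first and to compare what happens at the vertices of the move.
  In the first move one smoothing of the even vertex splits off a circle, the other one performs
  the move. In the second move two odd vertices form a bigon that is removable in the quotient;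
  two even vertices have four smoothings, one with a circle, two that cancel modulo 2, and one that
  performs the move. In the third move with three even vertices, one of the eight smoothings has a
  circle, three agree with each other, hence sum up to a single one, which equals a fourth smoothing
  on the other side of the move, and conversely; the remaining three are the same on both sides. With
  a single even
  vertex one smoothing leaves a removable bigon on both sides, with the same result, and the other
  one leaves isomorphic graphs. All these local identities compare how paths of glued half-edges
  connect the half-edges outside the triangle or bigon.
\<close>

subsection \<open>Gluing half-edges\<close>

text \<open>The difficulty is bookkeeping: smoothing, removing vertices and traversing unicursal
  components all reconnect half-edges, and a new edge may run through many removed half-edges or
  close up to a circle. All three are treated as one operation: a fixed-point-free involution glues
  a set \<open>R\<close> of half-edges on top of \<open>join\<close>. Two facts carry the proof:
  contracting an edge with both halves in \<open>R\<close> does not change the outcome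
  (\<open>contract\<close>), and gluing may be done in stages (\<open>gluing_compose\<close>).
  Removal in the first two moves is gluing along \<open>opp\<close>, so a smoothing performs the
  move when it and \<open>opp\<close> agree after contraction. Components are the classes of a
  complete gluing. The third move changes \<open>join\<close>, so an isomorphic copy is used that
  keeps half-edges and edges and changes \<open>vert\<close> and \<open>opp\<close> on the star of
  the triangle instead. Both sides are then gluings of the same twelve half-edges, compared by the
  induced pairing of the six outer ones. A parity speaks about knot graphs only, while partially
  smoothed graphs may have several components; hence \<open>bracket\<close> takes an arbitrary set
  of vertices, fixed before anything is smoothed.\<close>

definition fpf_involution :: "'a set \<Rightarrow> ('a \<Rightarrow> 'a) \<Rightarrow> bool" where
  "fpf_involution R s \<longleftrightarrow> (\<forall>h\<in>R. s h \<in> R \<and> s h \<noteq> h \<and> s (s h) = h)"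

text \<open>\<open>path_rel\<close> freed from the record: below, half-edges are discarded and
  \<open>join\<close> is replaced by \<open>other_end\<close> without carrying a graph
  along.\<close>

definition paths :: "'a set \<Rightarrow> ('a \<Rightarrow> 'a) \<Rightarrow> 'a set \<Rightarrow> ('a \<Rightarrow> 'a) \<Rightarrow> ('a \<times> 'a) set" where
  "paths H j R s = ({(h, j h) | h. h \<in> H} \<union> {(h, s h) | h. h \<in> R})\<^sup>*"

lemma path_rel_eq_paths: "path_rel G R \<sigma> = paths (halves G) (join G) R \<sigma>"
  by (simp add: path_rel_def paths_def)

lemma paths_refl [simp]: "(x, x) \<in> paths H j R s"
  by (simp add: paths_def)

lemma paths_trans: "(x, y) \<in> paths H j R s \<Longrightarrow> (y, z) \<in> paths H j R s \<Longrightarrow> (x, z) \<in> paths H j R s"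
  unfolding paths_def by (rule rtrancl_trans)

lemma paths_join: "h \<in> H \<Longrightarrow> (h, j h) \<in> paths H j R s"
  unfolding paths_def by (rule r_into_rtrancl) blast

lemma paths_glue: "h \<in> R \<Longrightarrow> (h, s h) \<in> paths H j R s"
  unfolding paths_def by (rule r_into_rtrancl) blast

lemma paths_induct [consumes 1, case_names refl join glue]:
  assumes "(x, y) \<in> paths H j R s"
    and "P x"
    and "\<And>h. (x, h) \<in> paths H j R s \<Longrightarrow> P h \<Longrightarrow> h \<in> H \<Longrightarrow> P (j h)"
    and "\<And>h. (x, h) \<in> paths H j R s \<Longrightarrow> P h \<Longrightarrow> h \<in> R \<Longrightarrow> P (s h)"
  shows "P y"
  using assms(1) unfolding paths_def
proof (induction rule: rtrancl_induct)
  case base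
  show ?case by (fact assms(2))
next
  case (step y z)
  have xy: "(x, y) \<in> paths H j R s" using step.hyps(1) by (simp add: paths_def)
  show ?case using step.hyps(2) assms(3)[OF xy step.IH] assms(4)[OF xy step.IH] by blast
qed

text \<open>A step may be sent to a whole path, even to a constant one, so \<open>p\<close> may
  collapse discarded half-edges onto survivors. Most inclusions between path relations below have
  this form.\<close>

lemma paths_map:
  assumes "(x, y) \<in> paths H j R s"
    and "\<And>h. h \<in> H \<Longrightarrow> (p h, p (j h)) \<in> paths H' j' R' s'"
    and "\<And>h. h \<in> R \<Longrightarrow> (p h, p (s h)) \<in> paths H' j' R' s'"
  shows "(p x, p y) \<in> paths H' j' R' s'"
  using assms(1)
proof (induction rule: paths_induct)
  case (join h)
  then show ?case using assms(2) paths_trans by metis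
next
  case (glue h)
  then show ?case using assms(3) paths_trans by metis
qed simp

lemma paths_closed:
  assumes "(x, y) \<in> paths H j R s" "x \<in> C"
    and "\<And>h. h \<in> C \<Longrightarrow> h \<in> H \<Longrightarrow> j h \<in> C" "\<And>h. h \<in> C \<Longrightarrow> h \<in> R \<Longrightarrow> s h \<in> C"
  shows "y \<in> C"
  using assms(1) by (induction rule: paths_induct) (use assms in auto)

lemma paths_cong:
  assumes "\<And>h. h \<in> H \<Longrightarrow> j h = j' h" "\<And>h. h \<in> R \<Longrightarrow> s h = s' h"
  shows "paths H j R s = paths H j' R s'"
proof -
  have "{(h, j h) | h. h \<in> H} = {(h, j' h) | h. h \<in> H}" "{(h, s h) | h. h \<in> R} = {(h, s' h) | h. h \<in> R}"
    using assms by auto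
  then show ?thesis by (simp add: paths_def)
qed

locale gluing =
  fixes H :: "'a set" and j :: "'a \<Rightarrow> 'a" and R :: "'a set" and s :: "'a \<Rightarrow> 'a"
  assumes finite_H: "finite H"
    and fpf_j: "fpf_involution H j"
    and R_sub: "R \<subseteq> H"
    and fpf_s: "fpf_involution R s"
begin

lemma j_in [simp]: "h \<in> H \<Longrightarrow> j h \<in> H"
  and j_neq [simp]: "h \<in> H \<Longrightarrow> j h \<noteq> h"
  and j_j [simp]: "h \<in> H \<Longrightarrow> j (j h) = h"
  and s_in [simp]: "h \<in> R \<Longrightarrow> s h \<in> R"
  and s_neq [simp]: "h \<in> R \<Longrightarrow> s h \<noteq> h"
  and s_s [simp]: "h \<in> R \<Longrightarrow> s (s h) = h"
  using fpf_j fpf_s by (auto simp: fpf_involution_def)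

lemma s_in_H [simp]: "h \<in> R \<Longrightarrow> s h \<in> H"
  using R_sub s_in by blast

lemma paths_in: "(x, y) \<in> paths H j R s \<Longrightarrow> x \<in> H \<Longrightarrow> y \<in> H"
  by (erule paths_closed) auto

lemma paths_sym: 
  assumes "(x, y) \<in> paths H j R s"
  shows "(y, x) \<in> paths H j R s"
  using assms
proof (induction rule: paths_induct)
  case (join h)
  have "(j h, h) \<in> paths H j R s" using paths_join[of "j h" H j R s] join by simp
  then show ?case using join paths_trans by metis
next
  case (glue h)
  have "(s h, h) \<in> paths H j R s" using paths_glue[of "s h" R s H j] glue by simp
  then show ?case using glue paths_trans by metis
qed simp

lemma equiv_paths: "equiv UNIV (paths H j R s)"
  by (intro equivI) (auto simp: refl_on_def sym_def trans_def intro: paths_sym paths_trans)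

text \<open>
  Following the path out of an end \<open>h\<close>, drop the first edge \<open>h, j h\<close>: the half-edge glued to
  \<open>j h\<close> becomes an end, and fewer half-edges remain glued.
\<close>

lemma drop_end:
  assumes "h \<in> H - R" "j h \<in> R"
  defines "a \<equiv> j h"
  defines "H' \<equiv> H - {h, a}" and "R' \<equiv> R - {a, s a}"
  shows "gluing H' j R' s"
    and "\<And>x y. x \<in> H' \<Longrightarrow> y \<in> H' \<Longrightarrow> (x, y) \<in> paths H j R s \<longleftrightarrow> (x, y) \<in> paths H' j R' s"
    and "(h, s a) \<in> paths H j R s"
proof -
  have a: "a \<in> R" "a \<in> H" "a \<noteq> h" "j a = h" "h \<in> H" "h \<notin> R" "j h = a"
    using assms R_sub by auto
  have sa: "s a \<noteq> a" "s a \<in> R" "s a \<noteq> h" using a s_in by (auto, metis s_in)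
  have jH: "j x \<in> H'" if "x \<in> H'" for x
    using that a unfolding H'_def by (metis DiffD1 DiffD2 DiffI insertCI insertE j_in j_j singletonD)
  have sR: "s x \<in> R'" if "x \<in> R'" for x
    using that a unfolding R'_def by (metis DiffD1 DiffD2 DiffI insertCI insertE s_in s_s singletonD)
  show "gluing H' j R' s"
  proof
    show "finite H'" using finite_H by (simp add: H'_def)
    show "fpf_involution H' j" using jH by (auto simp: fpf_involution_def H'_def)
    show "R' \<subseteq> H'" using R_sub a sa by (auto simp: H'_def R'_def)
    show "fpf_involution R' s" using sR by (auto simp: fpf_involution_def R'_def)
  qed
  show "(h, s a) \<in> paths H j R s"
    using paths_trans[of h a H j R s "s a"] paths_join[of h H j R s] paths_glue[of a R s H j] a by simp
  fix x y assume xy: "x \<in> H'" "y \<in> H'"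
  show "(x, y) \<in> paths H j R s \<longleftrightarrow> (x, y) \<in> paths H' j R' s"
  proof
    assume "(x, y) \<in> paths H j R s"
    \<comment> \<open>The retraction onto \<open>H'\<close>: the dropped edge is pushed along the
      path to the new end \<open>s a\<close>.\<close>
    define p where "p x = (if x \<in> {h, a} then s a else x)" for x
    have "(p x, p y) \<in> paths H' j R' s"
      using \<open>(x, y) \<in> paths H j R s\<close>
    proof (rule paths_map)
      fix k assume "k \<in> H"
      show "(p k, p (j k)) \<in> paths H' j R' s"
      proof (cases "k \<in> {h, a}")
        case True
        then show ?thesis using a by (auto simp: p_def)
      next
        case False
        then have k: "k \<in> H'" using \<open>k \<in> H\<close> by (simp add: H'_def)
        then have "p k = k" "p (j k) = j k" using jH[OF k] by (auto simp: p_def H'_def)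
        then show ?thesis using paths_join[OF k, of j R' s] by simp
      qed
    next
      fix k assume k: "k \<in> R"
      show "(p k, p (s k)) \<in> paths H' j R' s"
      proof (cases "k \<in> {a, s a}")
        case True
        then show ?thesis using a sa by (auto simp: p_def)
      next
        case False
        then have "k \<in> R'" using k by (simp add: R'_def)
        moreover have "s k \<noteq> h" using s_in[OF k] a(6) by metis
        then have "p k = k" "p (s k) = s k" using k False sR[OF \<open>k \<in> R'\<close>] a(6)
          by (auto simp: p_def R'_def)
        ultimately show ?thesis using paths_glue[of k R' s H' j] by simp
      qed
    qed
    moreover have "p x = x" "p y = y" using xy by (auto simp: p_def H'_def)
    ultimately show "(x, y) \<in> paths H' j R' s" by simp
  next
    assume "(x, y) \<in> paths H' j R' s"
    then have "(id x, id y) \<in> paths H j R s"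
      by (rule paths_map) (auto simp: H'_def R'_def intro: paths_join paths_glue)
    then show "(x, y) \<in> paths H j R s" by simp
  qed
qed

end

text \<open>This justifies the definite description in \<open>splice\<close>. Either the edge at
  \<open>h\<close> already ends outside \<open>R\<close>, or \<open>drop_end\<close> shortens the
  path at \<open>h\<close> and the new end \<open>s (j h)\<close> takes over the role of
  \<open>h\<close> in a smaller gluing.\<close>

lemma ex1_other_end:
  assumes "gluing H j R s" "h \<in> H - R"
  shows "\<exists>!k. k \<in> H - R \<and> k \<noteq> h \<and> (h, k) \<in> paths H j R s"
  using assms
proof (induction "card R" arbitrary: H R h rule: less_induct)
  case less
  interpret gluing H j R s by (fact less.prems)
  show ?case
  proof (cases "j h \<in> R")
    case False
    show ?thesis
    proof (rule ex1I[of _ "j h"])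
      show "j h \<in> H - R \<and> j h \<noteq> h \<and> (h, j h) \<in> paths H j R s"
        using less.prems(2) False by (auto intro: paths_join)
    next
      fix k assume k: "k \<in> H - R \<and> k \<noteq> h \<and> (h, k) \<in> paths H j R s"
      then have "k \<in> {h, j h}"
        by (elim conjE paths_closed) (use less.prems(2) False in auto)
      then show "k = j h" using k by simp
    qed
  next
    case True
    let ?a = "j h"
    let ?H = "H - {h, ?a}" and ?R = "R - {?a, s ?a}"
    note d = drop_end[OF less.prems(2) True]
    have fR: "finite R" using finite_H R_sub finite_subset by blast
    have sa: "s ?a \<in> R" "s ?a \<noteq> ?a" "s ?a \<noteq> h"
      using less.prems(2) True by (simp, simp, metis DiffD2 s_in)
    have "card ?R < card R" using True fR by (intro psubset_card_mono) auto
    moreover have "s ?a \<in> ?H - ?R" using sa R_sub by auto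
    ultimately have ex1: "\<exists>!k. k \<in> ?H - ?R \<and> k \<noteq> s ?a \<and> (s ?a, k) \<in> paths ?H j ?R s"
      using less.hyps[OF _ d(1)] by blast
    have ends: "k \<in> ?H - ?R \<and> k \<noteq> s ?a \<longleftrightarrow> k \<in> H - R \<and> k \<noteq> h" for k
      using sa R_sub True by auto
    have "(h, k) \<in> paths H j R s \<longleftrightarrow> (s ?a, k) \<in> paths ?H j ?R s" if "k \<in> H - R" "k \<noteq> h" for k
    proof -
      have "k \<in> ?H" "s ?a \<in> ?H" using that True sa R_sub by auto
      then have "(s ?a, k) \<in> paths H j R s \<longleftrightarrow> (s ?a, k) \<in> paths ?H j ?R s" by (rule d(2)[rotated])
      moreover have "(h, k) \<in> paths H j R s \<longleftrightarrow> (s ?a, k) \<in> paths H j R s"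
        using d(3) paths_trans[OF d(3)] paths_trans[OF paths_sym[OF d(3)]] by blast
      ultimately show ?thesis by simp
    qed
    then have "(\<lambda>k. k \<in> ?H - ?R \<and> k \<noteq> s ?a \<and> (s ?a, k) \<in> paths ?H j ?R s)
        = (\<lambda>k. k \<in> H - R \<and> k \<noteq> h \<and> (h, k) \<in> paths H j R s)"
      using ends by blast
    then show ?thesis using ex1 by simp
  qed
qed

text \<open>A class of \<open>r\<close> is recovered from any of its members in \<open>S\<close>,
  and its trace on \<open>S\<close> is a full class of \<open>r'\<close> because \<open>r'\<close>
  does not leave \<open>S\<close>. This transports class counts when half-edges outside
  \<open>S\<close> are forgotten.\<close>

lemma bij_betw_quotient_Int:
  assumes "equiv UNIV r" "equiv UNIV r'" "S \<subseteq> H"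
    and agree: "\<And>x y. x \<in> S \<Longrightarrow> y \<in> S \<Longrightarrow> (x, y) \<in> r \<longleftrightarrow> (x, y) \<in> r'"
    and closed: "\<And>x y. x \<in> S \<Longrightarrow> (x, y) \<in> r' \<Longrightarrow> y \<in> S"
  shows "bij_betw (\<lambda>C. C \<inter> S) {C \<in> H // r. C \<inter> S \<noteq> {}} (S // r')"
proof -
  have cls: "C = r `` {x}" if "C \<in> H // r" "x \<in> C" for C x
    using that assms(1) unfolding quotient_def equiv_def
    by (auto dest: symD transD)
  have int: "r `` {x} \<inter> S = r' `` {x}" if "x \<in> S" for x
    using agree closed that by auto
  have refl: "x \<in> r `` {x}" for x using assms(1) by (auto simp: equiv_def refl_on_def)
  show ?thesis
  proof (rule bij_betw_imageI)
    show "inj_on (\<lambda>C. C \<inter> S) {C \<in> H // r. C \<inter> S \<noteq> {}}"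
      by (rule inj_onI) (smt (verit) cls Int_iff disjoint_iff mem_Collect_eq)
    show "(\<lambda>C. C \<inter> S) ` {C \<in> H // r. C \<inter> S \<noteq> {}} = S // r'"
    proof (intro equalityI subsetI)
      fix D assume "D \<in> (\<lambda>C. C \<inter> S) ` {C \<in> H // r. C \<inter> S \<noteq> {}}"
      then obtain C x where "C \<in> H // r" "x \<in> C" "x \<in> S" "D = C \<inter> S" by auto
      then have "D = r' `` {x}" using cls int by metis
      then show "D \<in> S // r'" using \<open>x \<in> S\<close> by (auto simp: quotient_def)
    next
      fix D assume "D \<in> S // r'"
      then obtain x where x: "x \<in> S" "D = r' `` {x}" by (auto simp: quotient_def)
      have "r `` {x} \<in> H // r" using x assms(3) by (auto simp: quotient_def)
      moreover have "r `` {x} \<inter> S \<noteq> {}" using refl x by blast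
      ultimately show "D \<in> (\<lambda>C. C \<inter> S) ` {C \<in> H // r. C \<inter> S \<noteq> {}}"
        using int[OF x(1)] x(2) by blast
    qed
  qed
qed

lemma card_filter_bij_betw:
  assumes "bij_betw f A B" "\<And>x. x \<in> A \<Longrightarrow> P x \<longleftrightarrow> Q (f x)"
  shows "card {x \<in> A. P x} = card {y \<in> B. Q y}"
proof (rule bij_betw_same_card)
  show "bij_betw f {x \<in> A. P x} {y \<in> B. Q y}"
    using assms unfolding bij_betw_def inj_on_def by auto
qed

text \<open>For a \<open>gluing\<close>, each class of this relation consists of the two ends of one
  new edge, so it determines \<open>other_end\<close>; together with the number of
  \<open>loops\<close> it is all that \<open>splice\<close> keeps of the gluing.\<close>

definition ends :: "'a set \<Rightarrow> ('a \<Rightarrow> 'a) \<Rightarrow> 'a set \<Rightarrow> ('a \<Rightarrow> 'a) \<Rightarrow> ('a \<times> 'a) set" where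
  "ends H j R s = paths H j R s \<inter> (H - R) \<times> (H - R)"

definition loops :: "'a set \<Rightarrow> ('a \<Rightarrow> 'a) \<Rightarrow> 'a set \<Rightarrow> ('a \<Rightarrow> 'a) \<Rightarrow> 'a set set" where
  "loops H j R s = {C \<in> H // paths H j R s. C \<subseteq> R}"

definition other_end :: "'a set \<Rightarrow> ('a \<Rightarrow> 'a) \<Rightarrow> 'a set \<Rightarrow> ('a \<Rightarrow> 'a) \<Rightarrow> 'a \<Rightarrow> 'a" where
  "other_end H j R s h = (THE k. k \<in> H - R \<and> k \<noteq> h \<and> (h, k) \<in> paths H j R s)"

section \<open>Contraction and composition of gluings\<close>

context gluing
begin

lemma class_sub: "C \<in> H // paths H j R s \<Longrightarrow> C \<subseteq> H"
  by (auto simp: quotient_def intro: paths_in)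

lemma other_end:
  assumes "h \<in> H - R"
  shows "other_end H j R s h \<in> H - R" "other_end H j R s h \<noteq> h"
    "(h, other_end H j R s h) \<in> paths H j R s"
  using theI'[OF ex1_other_end[OF gluing_axioms assms]] by (auto simp: other_end_def)

lemma other_end_unique:
  assumes "h \<in> H - R" "k \<in> H - R" "k \<noteq> h" "(h, k) \<in> paths H j R s"
  shows "other_end H j R s h = k"
  unfolding other_end_def
  by (rule the1_equality[OF ex1_other_end[OF gluing_axioms assms(1)]]) (use assms in auto)

lemma fpf_other_end: "fpf_involution (H - R) (other_end H j R s)"
  unfolding fpf_involution_def
  using other_end other_end_unique paths_sym by metis

text \<open>The path \<open>s a, a, b, s b\<close> is shortened by gluing \<open>s a\<close>
  directly to \<open>s b\<close>. The assumption \<open>s a \<noteq> j a\<close> says that the edge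
  does not close up by itself; otherwise the contraction would lose a circle.\<close>

lemma contract:
  assumes "a \<in> R" "j a \<in> R" "s a \<noteq> j a"
  defines "b \<equiv> j a"
  defines "s' \<equiv> s(s a := s b, s b := s a)"
  shows "gluing (H - {a, b}) j (R - {a, b}) s'"
    and "ends H j R s = ends (H - {a, b}) j (R - {a, b}) s'"
    and "card (loops H j R s) = card (loops (H - {a, b}) j (R - {a, b}) s')"
proof -
  let ?H = "H - {a, b}" and ?R = "R - {a, b}"
  have ab: "a \<in> H" "b \<in> H" "a \<in> R" "b \<in> R" "j b = a" "j a = b" "a \<noteq> b"
  proof -
    have "a \<in> H" using assms(1) R_sub by blast
    then show "a \<in> H" "b \<in> H" "a \<in> R" "b \<in> R" "j b = a" "j a = b" "a \<noteq> b"
      using assms(1,2) j_neq[of a] unfolding b_def by (simp, simp, simp, simp, simp, simp, metis)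
  qed
  define a' b' where "a' = s a" and "b' = s b"
  have ab': "a' \<in> R" "b' \<in> R" "s a' = a" "s b' = b" "a' \<noteq> a" "b' \<noteq> b" "a' \<noteq> b"
    using ab assms(3) unfolding ab(6) by (simp_all add: a'_def b'_def)
  have "b' \<noteq> a" using ab' by (auto simp: a'_def)
  moreover have "a' \<noteq> b'" using ab' ab by metis
  ultimately have ba': "b' \<noteq> a" "a' \<noteq> b'" by simp_all
  have s': "s' = s(a' := b', b' := a')" by (simp add: s'_def a'_def b'_def)
  have jH: "j x \<in> ?H" if "x \<in> ?H" for x
    using that ab by (metis DiffD1 DiffD2 DiffI insertCI insertE j_in j_j singletonD)
  have sR: "s x \<in> ?R" if "x \<in> ?R" "x \<noteq> a'" "x \<noteq> b'" for x
    using that ab unfolding a'_def b'_def by (metis DiffD1 DiffD2 DiffI insertCI insertE s_in s_s singletonD)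
  have s'R: "s' x \<in> ?R \<and> s' x \<noteq> x \<and> s' (s' x) = x" if "x \<in> ?R" for x
  proof (cases "x = a' \<or> x = b'")
    case True
    then show ?thesis using ab' ba' by (auto simp: s')
  next
    case False
    then have "s x \<noteq> a'" "s x \<noteq> b'" using that ab' by (metis DiffE insertI1 s_s, metis DiffE insertI1 insertI2 s_s)
    then show ?thesis using sR[OF that] False that by (auto simp: s')
  qed
  show g: "gluing ?H j ?R s'"
  proof
    show "finite ?H" using finite_H by simp
    show "fpf_involution ?H j" using jH by (auto simp: fpf_involution_def)
    show "?R \<subseteq> ?H" using R_sub by auto
    show "fpf_involution ?R s'" using s'R by (simp add: fpf_involution_def)
  qed
  \<comment> \<open>The retraction onto the surviving half-edges moves \<open>a\<close> and
    \<open>b\<close> to the half-edges glued to them.\<close>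
  define p where "p = id(a := a', b := b')"
  have pH: "p x \<in> ?H \<and> (x, p x) \<in> paths H j R s" if "x \<in> H" for x
    using that ab ab' ba' R_sub paths_glue[of _ R s H j] by (auto simp: p_def a'_def b'_def)
  have agree: "(x, y) \<in> paths H j R s \<longleftrightarrow> (x, y) \<in> paths ?H j ?R s'" if xy: "x \<in> ?H" "y \<in> ?H" for x y
  proof
    assume "(x, y) \<in> paths H j R s"
    then have "(p x, p y) \<in> paths ?H j ?R s'"
    proof (rule paths_map)
      fix h assume h: "h \<in> H"
      have "(a', b') \<in> paths ?H j ?R s'" "(b', a') \<in> paths ?H j ?R s'"
        using paths_glue[of a' ?R s' ?H j] paths_glue[of b' ?R s' ?H j] ab' ba' by (auto simp: s')
      then show "(p h, p (j h)) \<in> paths ?H j ?R s'"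
        using ab h jH[of h] paths_join[of h ?H j ?R s'] by (auto simp: p_def)
    next
      fix h assume h: "h \<in> R"
      show "(p h, p (s h)) \<in> paths ?H j ?R s'"
      proof (cases "h \<in> {a, b, a', b'}")
        case True
        then show ?thesis using ab' ba' ab by (auto simp: p_def a'_def[symmetric] b'_def[symmetric])
      next
        case False
        then have "h \<in> ?R" using h by auto
        then show ?thesis using False sR[of h] paths_glue[of h ?R s' ?H j] by (auto simp: p_def s')
      qed
    qed
    then show "(x, y) \<in> paths ?H j ?R s'" using xy by (auto simp: p_def)
  next
    assume "(x, y) \<in> paths ?H j ?R s'"
    then have "(id x, id y) \<in> paths H j R s"
    proof (rule paths_map)
      fix h assume "h \<in> ?H"
      then show "(id h, id (j h)) \<in> paths H j R s" by (auto intro: paths_join)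
    next
      fix h assume h: "h \<in> ?R"
      have "(a', a) \<in> paths H j R s" "(a, b) \<in> paths H j R s" "(b, b') \<in> paths H j R s"
        using paths_glue[of _ R s H j] paths_join[of a H j R s] ab ab' by (auto simp: b'_def) metis
      then have "(a', b') \<in> paths H j R s" using paths_trans by metis
      then show "(id h, id (s' h)) \<in> paths H j R s"
        using paths_sym paths_glue[of h R s H j] h by (auto simp: s')
    qed
    then show "(x, y) \<in> paths H j R s" by simp
  qed
  have "H - R = ?H - ?R" using ab by auto
  then show "ends H j R s = ends ?H j ?R s'"
    unfolding ends_def using agree by auto
  interpret G': gluing ?H j ?R s' by (fact g)
  \<comment> \<open>No class disappears, since \<open>a\<close> and \<open>b\<close> are connected
    to the survivors \<open>a'\<close> and \<open>b'\<close>.\<close>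
  have meet: "C \<inter> ?H \<noteq> {}" if "C \<in> H // paths H j R s" for C
    using that pH by (fastforce simp: quotient_def)
  have "bij_betw (\<lambda>C. C \<inter> ?H) {C \<in> H // paths H j R s. C \<inter> ?H \<noteq> {}} (?H // paths ?H j ?R s')"
    by (rule bij_betw_quotient_Int[OF equiv_paths G'.equiv_paths])
       (use agree G'.paths_in in auto)
  moreover have "{C \<in> H // paths H j R s. C \<inter> ?H \<noteq> {}} = H // paths H j R s"
    using meet by auto
  ultimately have "bij_betw (\<lambda>C. C \<inter> ?H) (H // paths H j R s) (?H // paths ?H j ?R s')" by simp
  then show "card (loops H j R s) = card (loops ?H j ?R s')"
    unfolding loops_def
  proof (rule card_filter_bij_betw)
    fix C assume "C \<in> H // paths H j R s"
    then show "C \<subseteq> R \<longleftrightarrow> C \<inter> ?H \<subseteq> ?R" using class_sub ab by blast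
  qed
qed

end

text \<open>A path of the joint gluing decomposes into stretches through \<open>R\<close>, which are
  edges of the first result, and gluings in \<open>R'\<close>. A circle inside \<open>R\<close>
  arises at the first stage; every other circle meets \<open>S\<close> and is counted at the second
  stage, whence the sum.\<close>

lemma gluing_compose:
  assumes "gluing H j R s" "fpf_involution R' s'" "R' \<subseteq> H - R"
    and t: "\<And>h. h \<in> R \<Longrightarrow> t h = s h" "\<And>h. h \<in> R' \<Longrightarrow> t h = s' h"
  defines "S \<equiv> H - R" and "k \<equiv> other_end H j R s"
  shows "gluing H j (R \<union> R') t"
    and "gluing S k R' s'"
    and "ends H j (R \<union> R') t = ends S k R' s'"
    and "card (loops H j (R \<union> R') t) = card (loops S k R' s') + card (loops H j R s)"
proof -
  interpret gluing H j R s by (fact assms(1))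
  show g1: "gluing H j (R \<union> R') t"
    using assms(2,3) R_sub finite_H fpf_j fpf_s t
    by unfold_locales (auto simp: fpf_involution_def)
  show g2: "gluing S k R' s'"
    using assms(2,3) finite_H fpf_other_end unfolding S_def k_def by unfold_locales auto
  interpret G1: gluing H j "R \<union> R'" t by (fact g1)
  interpret G2: gluing S k R' s' by (fact g2)
  have sub: "(x, y) \<in> paths H j (R \<union> R') t" if "(x, y) \<in> paths H j R s" for x y
    using paths_map[OF that, of id] t by (metis UnCI id_apply paths_glue paths_join)
  have pS: "y = x \<or> y = k x" if "x \<in> S" "y \<in> S" "(x, y) \<in> paths H j R s" for x y
    using that other_end_unique unfolding S_def k_def by metis
  have agree: "(x, y) \<in> paths H j (R \<union> R') t \<longleftrightarrow> (x, y) \<in> paths S k R' s'" if xy: "x \<in> S" "y \<in> S" for x y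
  proof
    \<comment> \<open>Two survivors connected by the first gluing are equal or the ends of one edge
      of its result.\<close>
    have step: "(x, y) \<in> paths S k R' s'"
      if "z \<in> S" "(x, z) \<in> paths S k R' s'" "(z, y) \<in> paths H j R s" "y \<in> S" for z y
      using pS[of z y] that paths_join[of z S k R' s'] paths_trans by metis
    assume "(x, y) \<in> paths H j (R \<union> R') t"
    \<comment> \<open>Invariant along the path: the current half-edge, possibly inside
      \<open>R\<close>, hangs by first-stage steps on a survivor already reached at the second
      stage.\<close>
    then have "\<exists>z\<in>S. (x, z) \<in> paths S k R' s' \<and> (z, y) \<in> paths H j R s"
    proof (induction rule: paths_induct)
      case refl
      then show ?case using xy(1) paths_refl by metis
    next
      case (join h)
      then show ?case using paths_join[of h H j R s] paths_trans by metis
    next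
      case (glue h)
      then obtain z where z: "z \<in> S" "(x, z) \<in> paths S k R' s'" "(z, h) \<in> paths H j R s" by auto
      show ?case
      proof (cases "h \<in> R")
        case True
        then show ?thesis using z t paths_glue[of h R s H j] paths_trans by metis
      next
        case False
        then have h: "h \<in> R'" using glue by simp
        then have "(x, h) \<in> paths S k R' s'" using step[OF z] assms(3) S_def by auto
        then have "(x, s' h) \<in> paths S k R' s'" using h paths_glue paths_trans by metis
        then show ?thesis using t(2)[OF h] G2.s_in_H[OF h] paths_refl by metis
      qed
    qed
    then show "(x, y) \<in> paths S k R' s'" using step xy(2) by blast
  next
    assume "(x, y) \<in> paths S k R' s'"
    then have "(id x, id y) \<in> paths H j (R \<union> R') t"
    proof (rule paths_map)
      fix h assume "h \<in> S"
      then show "(id h, id (k h)) \<in> paths H j (R \<union> R') t"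
        using other_end(3)[of h] sub by (simp add: k_def S_def)
    next
      fix h assume "h \<in> R'"
      then show "(id h, id (s' h)) \<in> paths H j (R \<union> R') t"
        using paths_glue[of h "R \<union> R'" t H j] t(2) by simp
    qed
    then show "(x, y) \<in> paths H j (R \<union> R') t" by simp
  qed
  have "H - (R \<union> R') = S - R'" by (auto simp: S_def)
  then show "ends H j (R \<union> R') t = ends S k R' s'"
    unfolding ends_def using agree by auto
  let ?r = "paths H j (R \<union> R') t"
  \<comment> \<open>Circles are separated into those meeting \<open>S\<close>, which are
    second-stage circles, and those inside \<open>R\<close>, which are first-stage circles.\<close>
  let ?A = "{C \<in> {C \<in> H // ?r. C \<inter> S \<noteq> {}}. C \<subseteq> R \<union> R'}"
  let ?B = "{C \<in> H // ?r. C \<subseteq> R}"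
  have "bij_betw (\<lambda>C. C \<inter> S) {C \<in> H // ?r. C \<inter> S \<noteq> {}} (S // paths S k R' s')"
    by (rule bij_betw_quotient_Int[OF G1.equiv_paths G2.equiv_paths])
       (use agree G2.paths_in in \<open>auto simp: S_def\<close>)
  then have "card ?A = card (loops S k R' s')"
    unfolding loops_def
  proof (rule card_filter_bij_betw)
    fix C assume "C \<in> {C \<in> H // ?r. C \<inter> S \<noteq> {}}"
    then have "C \<subseteq> H" using G1.class_sub by simp
    then show "C \<subseteq> R \<union> R' \<longleftrightarrow> C \<inter> S \<subseteq> R'" using assms(3) by (auto simp: S_def)
  qed
  moreover have BL: "?B = loops H j R s"
  proof -
    \<comment> \<open>A class inside \<open>R\<close>, for either relation, never reaches
      \<open>R'\<close>, where alone the two gluings differ.\<close>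
    have eq: "?r `` {x} = paths H j R s `` {x}"
      if "?r `` {x} \<subseteq> R \<or> paths H j R s `` {x} \<subseteq> R" for x
    proof
      show "paths H j R s `` {x} \<subseteq> ?r `` {x}" using sub by auto
      show "?r `` {x} \<subseteq> paths H j R s `` {x}"
      proof
        fix y assume "y \<in> ?r `` {x}"
        then have "(x, y) \<in> ?r" by simp
        then have "(x, y) \<in> paths H j R s"
        proof (induction rule: paths_induct)
          case (join h)
          then show ?case using paths_join[of h H j R s] paths_trans by metis
        next
          case (glue h)
          then have "h \<in> R" using that by auto
          then show ?case using glue t paths_glue[of h R s H j] paths_trans by metis
        qed simp
        then show "y \<in> paths H j R s `` {x}" by simp
      qed
    qed
    show ?thesis unfolding loops_def quotient_def using eq by (auto; blast)
  qed
  moreover have "loops H j (R \<union> R') t = ?A \<union> ?B"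
  proof -
    have "C \<subseteq> R" if "C \<inter> S = {}" "C \<in> H // ?r" for C using that G1.class_sub by (auto simp: S_def)
    then show ?thesis by (auto simp: loops_def)
  qed
  moreover have "?A \<inter> ?B = {}" by (auto simp: S_def)
  then have "finite (H // ?r) \<Longrightarrow> card (?A \<union> ?B) = card ?A + card ?B"
    by (intro card_Un_disjoint) auto
  moreover have "finite (H // ?r)" using finite_H by (simp add: quotient_def)
  ultimately show "card (loops H j (R \<union> R') t) = card (loops S k R' s') + card (loops H j R s)"
    by (simp only:)
qed

lemma ends_iff: "(h, k) \<in> ends H j R s \<longleftrightarrow> h \<in> H - R \<and> k \<in> H - R \<and> (h, k) \<in> paths H j R s"
  by (auto simp: ends_def)

lemma other_end_eqI:
  assumes "ends H j R s = ends H' j' R' s'" "H - R = H' - R'" "h \<in> H - R"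
  shows "other_end H j R s h = other_end H' j' R' s' h"
proof -
  have "k \<in> H - R \<and> k \<noteq> h \<and> (h, k) \<in> paths H j R s \<longleftrightarrow>
      k \<in> H' - R' \<and> k \<noteq> h \<and> (h, k) \<in> paths H' j' R' s'" for k
    using assms ends_iff[of h k H j R s] ends_iff[of h k H' j' R' s'] by blast
  then show ?thesis by (simp add: other_end_def)
qed

lemma (in gluing) paths_image:
  assumes "inj_on f H" "\<And>h. h \<in> H \<Longrightarrow> j' (f h) = f (j h)" "\<And>h. h \<in> R \<Longrightarrow> s' (f h) = f (s h)"
    and "x \<in> H"
  shows "paths (f ` H) j' (f ` R) s' `` {f x} = f ` (paths H j R s `` {x})"
proof
  show "f ` (paths H j R s `` {x}) \<subseteq> paths (f ` H) j' (f ` R) s' `` {f x}"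
  proof clarsimp
    fix y assume "(x, y) \<in> paths H j R s"
    then show "(f x, f y) \<in> paths (f ` H) j' (f ` R) s'"
    proof (rule paths_map)
      fix h assume "h \<in> H"
      then show "(f h, f (j h)) \<in> paths (f ` H) j' (f ` R) s'"
        using paths_join[of "f h" "f ` H" j'] assms(2) by (metis imageI)
    next
      fix h assume "h \<in> R"
      then show "(f h, f (s h)) \<in> paths (f ` H) j' (f ` R) s'"
        using paths_glue[of "f h" "f ` R" s'] assms(3) by (metis imageI)
    qed
  qed
  show "paths (f ` H) j' (f ` R) s' `` {f x} \<subseteq> f ` (paths H j R s `` {x})"
  proof clarsimp
    fix y assume "(f x, y) \<in> paths (f ` H) j' (f ` R) s'"
    then show "y \<in> f ` (paths H j R s `` {x})"
    proof (rule paths_closed)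
      show "f x \<in> f ` (paths H j R s `` {x})" by simp
    next
      fix k assume "k \<in> f ` (paths H j R s `` {x})"
      then obtain h where h: "k = f h" "(x, h) \<in> paths H j R s" by auto
      then have "h \<in> H" using paths_in assms(4) by blast
      then show "j' k \<in> f ` (paths H j R s `` {x})"
        using h paths_trans[OF h(2) paths_join] assms(2) by auto
    next
      fix k assume "k \<in> f ` (paths H j R s `` {x})" "k \<in> f ` R"
      then obtain h h' where h: "k = f h" "(x, h) \<in> paths H j R s" "k = f h'" "h' \<in> R" by blast
      then have "h \<in> H" using paths_in assms(4) by blast
      then have "h \<in> R" using h assms(1) R_sub by (metis inj_onD subsetD)
      then show "s' k \<in> f ` (paths H j R s `` {x})"
        using h paths_trans[OF h(2) paths_glue] assms(3) by auto
    qed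
  qed
qed

lemma (in gluing) card_loops_image:
  assumes "inj_on f H" "\<And>h. h \<in> H \<Longrightarrow> j' (f h) = f (j h)" "\<And>h. h \<in> R \<Longrightarrow> s' (f h) = f (s h)"
  shows "card (loops (f ` H) j' (f ` R) s') = card (loops H j R s)"
proof -
  have "bij_betw ((`) f) (H // paths H j R s) (f ` H // paths (f ` H) j' (f ` R) s')"
  proof (rule bij_betw_imageI)
    show "inj_on ((`) f) (H // paths H j R s)"
      using inj_on_image_eq_iff[OF assms(1)] class_sub by (intro inj_onI) blast
    show "(`) f ` (H // paths H j R s) = f ` H // paths (f ` H) j' (f ` R) s'"
      using paths_image[OF assms] by (auto simp: quotient_def)
  qed
  then have "card {C \<in> H // paths H j R s. C \<subseteq> R} =
      card {C \<in> (f ` H) // paths (f ` H) j' (f ` R) s'. C \<subseteq> f ` R}"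
  proof (rule card_filter_bij_betw)
    fix C assume "C \<in> H // paths H j R s"
    then have "C \<subseteq> H" by (rule class_sub)
    then show "C \<subseteq> R \<longleftrightarrow> f ` C \<subseteq> f ` R"
      using inj_on_image_mem_iff[OF assms(1) _ R_sub] by blast
  qed
  then show ?thesis by (simp add: loops_def)
qed

lemma (in gluing) other_end_image:
  assumes "inj_on f H" "\<And>h. h \<in> H \<Longrightarrow> j' (f h) = f (j h)" "\<And>h. h \<in> R \<Longrightarrow> s' (f h) = f (s h)"
    and "gluing (f ` H) j' (f ` R) s'" "h \<in> H - R"
  shows "other_end (f ` H) j' (f ` R) s' (f h) = f (other_end H j R s h)"
proof (rule gluing.other_end_unique[OF assms(4)])
  note e = other_end[OF assms(5)]
  have img: "f k \<in> f ` H - f ` R" if "k \<in> H - R" for k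
    using that R_sub inj_on_image_set_diff[OF assms(1), of H R] by blast
  show "f h \<in> f ` H - f ` R" "f (other_end H j R s h) \<in> f ` H - f ` R"
    using img e(1) assms(5) by auto
  show "f (other_end H j R s h) \<noteq> f h"
    using e assms(1,5) by (metis DiffD1 inj_onD)
  show "(f h, f (other_end H j R s h)) \<in> paths (f ` H) j' (f ` R) s'"
    using paths_image[OF assms(1-3), of h] e(3) assms(5) by auto
qed

text \<open>The class of \<open>x\<close> cannot leave the set \<open>E\<close>, which is stable
  under both involutions, so \<open>y\<close> lies in a different class.\<close>

lemma two_loops:
  assumes "gluing H j H s" "E \<subseteq> H" "x \<in> E" "y \<in> H - E"
    and "\<And>h. h \<in> E \<Longrightarrow> j h \<in> E" "\<And>h. h \<in> E \<Longrightarrow> s h \<in> E"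
  shows "card (loops H j H s) \<ge> 2"
proof -
  interpret gluing H j H s by (fact assms(1))
  let ?r = "paths H j H s"
  have sub: "?r `` {x} \<subseteq> E"
    using paths_closed[of x _ H j H s E] assms by auto
  have fin: "finite (loops H j H s)" using finite_H by (simp add: loops_def quotient_def)
  have "{?r `` {x}, ?r `` {y}} \<subseteq> loops H j H s"
    using assms(2-4) class_sub by (auto simp: loops_def quotient_def intro: paths_in)
  moreover have "?r `` {x} \<noteq> ?r `` {y}" using sub assms(4) by (metis DiffD2 ImageI paths_refl singletonI subsetD)
  ultimately show ?thesis using card_mono[OF fin] by (metis card_2_iff)
qed

subsection \<open>Splicing framed graphs\<close>

lemma halves_at_iff [simp]: "h \<in> halves_at G W \<longleftrightarrow> h \<in> halves G \<and> vert G h \<in> W"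
  by (simp add: halves_at_def)

lemma framed_4_graphD:
  assumes "framed_4_graph G"
  shows "finite (halves G)" "fpf_involution (halves G) (join G)"
    "fpf_involution (halves_at G W) (opp G)"
    "h \<in> halves G \<Longrightarrow> opp G h \<in> halves G" "h \<in> halves G \<Longrightarrow> opp G h \<noteq> h"
    "h \<in> halves G \<Longrightarrow> opp G (opp G h) = h" "h \<in> halves G \<Longrightarrow> vert G (opp G h) = vert G h"
    "h \<in> halves G \<Longrightarrow> join G h \<in> halves G" "h \<in> halves G \<Longrightarrow> join G h \<noteq> h"
    "h \<in> halves G \<Longrightarrow> join G (join G h) = h"
  using assms by (auto simp: framed_4_graph_def fpf_involution_def)

lemma framed_gluing:
  assumes "framed_4_graph G" "fpf_involution (halves_at G W) \<sigma>"
  shows "gluing (halves G) (join G) (halves_at G W) \<sigma>"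
  using assms framed_4_graphD[OF assms(1)] by unfold_locales auto

lemma splice_simps [simp]:
  "halves (splice G R \<sigma>) = halves G - R"
  "vert (splice G R \<sigma>) = vert G"
  "opp (splice G R \<sigma>) = opp G"
  "join (splice G R \<sigma>) = other_end (halves G) (join G) R \<sigma>"
  "circles (splice G R \<sigma>) = circles G + card (loops (halves G) (join G) R \<sigma>)"
  by (auto simp: splice_def other_end_def path_rel_eq_paths loops_def)

lemma halves_at_splice: "halves_at (splice G (halves_at G W) \<sigma>) V = halves_at G (V - W)"
  by auto

lemma verts_splice: "verts (splice G (halves_at G W) \<sigma>) = verts G - W"
  by (auto simp: verts_def)

lemma framed_splice:
  assumes "framed_4_graph G" "fpf_involution (halves_at G W) \<sigma>"
  shows "framed_4_graph (splice G (halves_at G W) \<sigma>)"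
proof -
  interpret gluing "halves G" "join G" "halves_at G W" \<sigma>
    by (rule framed_gluing) fact+
  have "card (halves_at G ({v} - W)) = 4" if "v \<in> verts G - W" for v
  proof -
    have "{v} - W = {v}" using that by auto
    then show ?thesis using that assms(1) by (auto simp: framed_4_graph_def)
  qed
  then show ?thesis
    using framed_4_graphD[OF assms(1)] fpf_other_end
    unfolding framed_4_graph_def verts_splice halves_at_splice by (auto simp: fpf_involution_def)
qed

text \<open>When all half-edges are glued, every class is a loop; this puts the component number
  within reach of the results on \<open>loops\<close>.\<close>

lemma num_unicursal_eq_loops:
  assumes "framed_4_graph G"
  shows "num_unicursal G = card (loops (halves G) (join G) (halves G) (opp G)) + circles G"
proof -
  have "halves_at G UNIV = halves G" by auto
  then interpret gluing "halves G" "join G" "halves G" "opp G"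
    using framed_gluing[OF assms framed_4_graphD(3)[OF assms], of UNIV] by simp
  show ?thesis using class_sub
    by (auto simp: num_unicursal_def loops_def path_rel_eq_paths intro!: arg_cong[of _ _ card])
qed

text \<open>Traversing the spliced graph means gluing the surviving half-edges along
  \<open>opp\<close> as a second stage. By \<open>gluing_compose\<close> its components are
  therefore counted in the original graph, by one gluing \<open>t\<close> of all half-edges.\<close>

lemma num_unicursal_splice:
  assumes "framed_4_graph G" "fpf_involution (halves_at G W) \<sigma>"
    and "\<And>h. h \<in> halves_at G W \<Longrightarrow> t h = \<sigma> h" "\<And>h. h \<in> halves G - halves_at G W \<Longrightarrow> t h = opp G h"
  shows "num_unicursal (splice G (halves_at G W) \<sigma>)
      = card (loops (halves G) (join G) (halves G) t) + circles G"
    and "gluing (halves G) (join G) (halves G) t"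
proof -
  let ?S = "splice G (halves_at G W) \<sigma>"
  have fpf: "fpf_involution (halves G - halves_at G W) (opp G)"
    using framed_4_graphD[OF assms(1)] by (auto simp: fpf_involution_def)
  have U: "halves_at G W \<union> (halves G - halves_at G W) = halves G" by auto
  note c = gluing_compose[OF framed_gluing[OF assms(1,2)] fpf subset_refl assms(3,4), unfolded U]
  show "gluing (halves G) (join G) (halves G) t" by (rule c(1))
  show "num_unicursal ?S = card (loops (halves G) (join G) (halves G) t) + circles G"
    unfolding num_unicursal_eq_loops[OF framed_splice[OF assms(1,2)]] using c(4) by simp
qed

text \<open>Here both stages glue along \<open>opp\<close>, so the two counts are the same. This
  covers both removal moves.\<close>

lemma num_unicursal_splice_opp:
  assumes "framed_4_graph G"
  shows "num_unicursal (splice G (halves_at G W) (opp G)) = num_unicursal G"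
  using num_unicursal_splice(1)[OF assms framed_4_graphD(3)[OF assms], of W "opp G"]
    num_unicursal_eq_loops[OF assms] by simp

lemma framed_iso_id:
  "framed_iso X Y id id \<longleftrightarrow> halves X = halves Y \<and> circles X = circles Y \<and>
    (\<forall>h\<in>halves X. vert X h = vert Y h \<and> opp X h = opp Y h \<and> join X h = join Y h)"
  by (auto simp: framed_iso_def bij_betw_def verts_def)

lemma framed_iso_splice_id:
  assumes "ends (halves G) (join G) R \<sigma> = ends (halves G') (join G') R' \<sigma>'"
    and "halves G - R = halves G' - R'"
    and "\<And>h. h \<in> halves G - R \<Longrightarrow> vert G h = vert G' h \<and> opp G h = opp G' h"
    and "circles G + card (loops (halves G) (join G) R \<sigma>) =
      circles G' + card (loops (halves G') (join G') R' \<sigma>')"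
  shows "framed_iso (splice G R \<sigma>) (splice G' R' \<sigma>') id id"
  using assms other_end_eqI[OF assms(1,2)] by (auto simp: framed_iso_id)

text \<open>An isomorphism by the identity rather than an equality: the two \<open>join\<close>
  functions are compared on surviving half-edges only.\<close>

lemma framed_iso_splice_splice:
  assumes "framed_4_graph G" "W \<inter> V = {}"
    and "fpf_involution (halves_at G W) \<sigma>" "fpf_involution (halves_at G V) \<sigma>'"
    and "\<And>h. h \<in> halves_at G W \<Longrightarrow> t h = \<sigma> h" "\<And>h. h \<in> halves_at G V \<Longrightarrow> t h = \<sigma>' h"
  shows "framed_iso (splice G (halves_at G (W \<union> V)) t)
    (splice (splice G (halves_at G W) \<sigma>) (halves_at G V) \<sigma>') id id"
    and "fpf_involution (halves_at G (W \<union> V)) t"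
proof -
  have sub: "halves_at G V \<subseteq> halves G - halves_at G W" using assms(2) by auto
  have U: "halves_at G (W \<union> V) = halves_at G W \<union> halves_at G V" by auto
  note c = gluing_compose[OF framed_gluing[OF assms(1,3)] assms(4) sub assms(5,6)]
  show "framed_iso (splice G (halves_at G (W \<union> V)) t)
    (splice (splice G (halves_at G W) \<sigma>) (halves_at G V) \<sigma>') id id"
    unfolding U by (rule framed_iso_splice_id) (use c in auto)
  show "fpf_involution (halves_at G (W \<union> V)) t"
    unfolding U using gluing.fpf_s[OF c(1)] .
qed

subsection \<open>Isomorphisms\<close>

lemma framed_isoD:
  assumes "framed_iso G G' f g"
  shows "halves G' = f ` halves G" "inj_on f (halves G)" "verts G' = g ` verts G" "inj_on g (verts G)"
    "h \<in> halves G \<Longrightarrow> vert G' (f h) = g (vert G h)"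
    "h \<in> halves G \<Longrightarrow> opp G' (f h) = f (opp G h)"
    "h \<in> halves G \<Longrightarrow> join G' (f h) = f (join G h)"
    "circles G' = circles G"
  using assms by (auto simp: framed_iso_def bij_betw_def)

lemma halves_at_iso:
  assumes "framed_iso G G' f g" "W \<subseteq> verts G"
  shows "halves_at G' (g ` W) = f ` halves_at G W"
proof -
  note I = framed_isoD[OF assms(1)]
  have "vert G' (f h) \<in> g ` W \<longleftrightarrow> vert G h \<in> W" if "h \<in> halves G" for h
    unfolding I(5)[OF that] using that
    by (intro inj_on_image_mem_iff[OF I(4) _ assms(2)]) (simp add: verts_def)
  then show ?thesis unfolding halves_at_def I(1) by blast
qed

lemma framed_iso_splice:
  assumes "framed_4_graph G" "framed_4_graph G'" "framed_iso G G' f g" "W \<subseteq> verts G"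
    and "fpf_involution (halves_at G W) \<sigma>" "\<And>h. h \<in> halves_at G W \<Longrightarrow> \<sigma>' (f h) = f (\<sigma> h)"
  shows "framed_iso (splice G (halves_at G W) \<sigma>) (splice G' (halves_at G' (g ` W)) \<sigma>') f g"
proof -
  interpret gluing "halves G" "join G" "halves_at G W" \<sigma>
    by (rule framed_gluing) fact+
  note I = framed_isoD[OF assms(3)]
  have R': "halves_at G' (g ` W) = f ` halves_at G W" by (rule halves_at_iso) fact+
  have "fpf_involution (halves_at G' (g ` W)) \<sigma>'"
    unfolding R' fpf_involution_def
  proof
    fix k assume "k \<in> f ` halves_at G W"
    then obtain h where h: "h \<in> halves_at G W" "k = f h" by blast
    moreover have "f (\<sigma> h) \<noteq> f h"
      using s_in[OF h(1)] s_neq[OF h(1)] h(1) R_sub I(2) by (metis inj_onD subsetD)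
    ultimately show "\<sigma>' k \<in> f ` halves_at G W \<and> \<sigma>' k \<noteq> k \<and> \<sigma>' (\<sigma>' k) = k"
      using assms(6)[OF h(1)] assms(6)[OF s_in[OF h(1)]] s_in[OF h(1)] s_s[OF h(1)] by simp
  qed
  then have g': "gluing (f ` halves G) (join G') (f ` halves_at G W) \<sigma>'"
    using framed_gluing[OF assms(2), of "g ` W" \<sigma>'] R' I(1) by simp
  have "bij_betw f (halves G - halves_at G W) (f ` halves G - f ` halves_at G W)"
    using I(2) R_sub by (metis Diff_subset bij_betw_subset inj_on_image_set_diff inj_on_imp_bij_betw order_refl)
  moreover have "bij_betw g (verts G - W) (g ` verts G - g ` W)"
    using I(4) assms(4) by (metis Diff_subset bij_betw_subset inj_on_image_set_diff inj_on_imp_bij_betw order_refl)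
  ultimately show ?thesis
    using I other_end_image[OF I(2,7) assms(6) g'] card_loops_image[OF I(2,7) assms(6)]
    unfolding framed_iso_def verts_splice unfolding splice_simps R' by auto
qed

lemma num_unicursal_iso:
  assumes "framed_4_graph G" "framed_4_graph G'" "framed_iso G G' f g"
  shows "num_unicursal G' = num_unicursal G"
proof -
  have "halves_at G UNIV = halves G" by auto
  then interpret gluing "halves G" "join G" "halves G" "opp G"
    using framed_gluing[OF assms(1) framed_4_graphD(3)[OF assms(1)], of UNIV] by simp
  note I = framed_isoD[OF assms(3)]
  show ?thesis
    using card_loops_image[OF I(2,7,6)] I(1,8)
    by (simp add: num_unicursal_eq_loops assms)
qed

text \<open>The value 0 moves the condition of having one component from the index set of the
  bracket into its summands, so that sums run over all smoothing choices and factor over disjoint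
  sets of vertices.\<close>

definition knot_term :: "framed_graph \<Rightarrow> knot_graph_mod_R2 \<Rightarrow>\<^sub>0 bit" where
  "knot_term X = (if num_unicursal X = 1 then Poly_Mapping.single (abs_knot_graph_mod_R2 X) 1 else 0)"

lemma knot_term_eqI:
  assumes "framed_4_graph X" "framed_4_graph Y" "num_unicursal X = num_unicursal Y"
    and "(\<exists>f g. framed_iso X Y f g) \<or> (\<exists>u v. R2_removal X u v Y)"
  shows "knot_term X = knot_term Y"
proof (cases "num_unicursal X = 1")
  case True
  then have "R2_step X Y" using assms by (auto simp: R2_step_def framed_knot_graph_def)
  then have "R2_equiv X Y"
    using r_into_equivclp[of R2_step X Y] by (simp add: R2_equiv_def R2_step_def)
  then have "abs_knot_graph_mod_R2 X = abs_knot_graph_mod_R2 Y"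
    by (rule Quotient_rel_abs[OF Quotient_knot_graph_mod_R2])
  then show ?thesis using assms(3) by (simp add: knot_term_def)
qed (use assms(3) in \<open>simp add: knot_term_def\<close>)

lemma knot_term_iso:
  assumes "framed_4_graph X" "framed_4_graph Y" "framed_iso X Y f g"
  shows "knot_term X = knot_term Y"
  using knot_term_eqI num_unicursal_iso assms by metis

lemma knot_term_R2:
  assumes "framed_4_graph X" "R2_removal X u v Y"
  shows "knot_term X = knot_term Y"
proof -
  have "Y = splice X (halves_at X {u, v}) (opp X)" using assms(2) by (simp add: R2_removal_def)
  then show ?thesis
    using knot_term_eqI[OF assms(1), of Y] assms framed_splice[OF assms(1) framed_4_graphD(3)[OF assms(1)]]
      num_unicursal_splice_opp[OF assms(1)] by metis
qed

lemma add_self_bit [simp]: "(x :: 'a \<Rightarrow>\<^sub>0 bit) + x = 0"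
  by (rule poly_mapping_eqI) (simp add: lookup_add)

lemma add_left_self_bit [simp]: "(x :: 'a \<Rightarrow>\<^sub>0 bit) + (x + y) = y"
  by (simp flip: add.assoc)

subsection \<open>Sums over smoothings\<close>

definition bracket :: "framed_graph \<Rightarrow> nat set \<Rightarrow> knot_graph_mod_R2 \<Rightarrow>\<^sub>0 bit" where
  "bracket G W = (\<Sum>\<sigma> | smoothing_choice G W \<sigma>. knot_term (smooth G W \<sigma>))"

lemma smoothing_choice_fpf: "smoothing_choice G W \<sigma> \<Longrightarrow> fpf_involution (halves_at G W) \<sigma>"
  by (auto simp: smoothing_choice_def fpf_involution_def)

lemma smoothing_choiceD:
  assumes "smoothing_choice G W \<sigma>"
  shows "h \<in> halves G \<Longrightarrow> vert G h \<in> W \<Longrightarrow> \<sigma> h \<in> halves G \<and> vert G (\<sigma> h) = vert G h \<and>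
      \<sigma> h \<noteq> h \<and> \<sigma> h \<noteq> opp G h \<and> \<sigma> (\<sigma> h) = h"
    and "h \<notin> halves_at G W \<Longrightarrow> \<sigma> h = h"
  using assms unfolding smoothing_choice_def by auto

lemma smoothing_choiceI:
  assumes "\<And>h. h \<in> halves_at G W \<Longrightarrow> \<sigma> h \<in> halves_at G W \<and> vert G (\<sigma> h) = vert G h \<and>
      \<sigma> h \<noteq> h \<and> \<sigma> h \<noteq> opp G h \<and> \<sigma> (\<sigma> h) = h"
    and "\<And>h. h \<notin> halves_at G W \<Longrightarrow> \<sigma> h = h"
  shows "smoothing_choice G W \<sigma>"
  using assms by (auto simp: smoothing_choice_def)

text \<open>A choice is the identity off its own star, so composing choices on disjoint stars just
  puts them side by side.\<close>

lemma smoothing_choice_comp: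
  assumes "W \<inter> V = {}" "smoothing_choice G W \<sigma>" "smoothing_choice G V \<tau>"
  shows "h \<in> halves_at G W \<Longrightarrow> (\<sigma> \<circ> \<tau>) h = \<sigma> h" "h \<in> halves_at G V \<Longrightarrow> (\<sigma> \<circ> \<tau>) h = \<tau> h"
    "smoothing_choice G (W \<union> V) (\<sigma> \<circ> \<tau>)"
proof -
  note s = smoothing_choiceD[OF assms(2)] and t = smoothing_choiceD[OF assms(3)]
  have W: "(\<sigma> \<circ> \<tau>) h = \<sigma> h" if "h \<in> halves_at G W" for h
  proof -
    have "h \<notin> halves_at G V" using that assms(1) by auto
    then show ?thesis using t(2) by simp
  qed
  have V: "(\<sigma> \<circ> \<tau>) h = \<tau> h" if "h \<in> halves_at G V" for h
  proof -
    have "\<tau> h \<notin> halves_at G W" using that t(1)[of h] assms(1) by auto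
    then show ?thesis using s(2) by simp
  qed
  show "h \<in> halves_at G W \<Longrightarrow> (\<sigma> \<circ> \<tau>) h = \<sigma> h" "h \<in> halves_at G V \<Longrightarrow> (\<sigma> \<circ> \<tau>) h = \<tau> h"
    by (fact W, fact V)
  define \<rho> where "\<rho> = \<sigma> \<circ> \<tau>"
  have "\<rho> h \<in> halves G \<and> vert G (\<rho> h) = vert G h \<and> \<rho> h \<noteq> h \<and> \<rho> h \<noteq> opp G h \<and> \<rho> (\<rho> h) = h"
    if "h \<in> halves_at G W" for h
    using that s(1)[of h] W[of h] W[of "\<sigma> h"] by (simp add: \<rho>_def del: comp_apply)
  moreover have "\<rho> h \<in> halves G \<and> vert G (\<rho> h) = vert G h \<and> \<rho> h \<noteq> h \<and> \<rho> h \<noteq> opp G h \<and> \<rho> (\<rho> h) = h"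
    if "h \<in> halves_at G V" for h
    using that t(1)[of h] V[of h] V[of "\<tau> h"] by (simp add: \<rho>_def del: comp_apply)
  moreover have "\<rho> h = h" if "h \<notin> halves_at G W" "h \<notin> halves_at G V" for h
    using that s(2) t(2) by (simp add: \<rho>_def del: halves_at_iff)
  moreover have "halves_at G (W \<union> V) = halves_at G W \<union> halves_at G V" by auto
  ultimately show "smoothing_choice G (W \<union> V) (\<sigma> \<circ> \<tau>)"
    unfolding \<rho>_def[symmetric] smoothing_choice_def by blast
qed

lemma finite_smoothing_choices:
  assumes "framed_4_graph G"
  shows "finite {\<sigma>. smoothing_choice G W \<sigma>}"
proof (rule finite_subset)
  show "{\<sigma>. smoothing_choice G W \<sigma>} \<subseteq> {\<sigma>. \<sigma> permutes halves_at G W}"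
  proof clarify
    fix \<sigma> assume c: "smoothing_choice G W \<sigma>"
    have "\<sigma> (\<sigma> h) = h" for h
      using c unfolding smoothing_choice_def by (cases "h \<in> halves_at G W") metis+
    moreover have "\<sigma> h = h" if "h \<notin> halves_at G W" for h
      using c that unfolding smoothing_choice_def by blast
    ultimately show "\<sigma> permutes halves_at G W" unfolding permutes_def by metis
  qed
  show "finite {\<sigma>. \<sigma> permutes halves_at G W}"
    using framed_4_graphD(1)[OF assms] by (intro finite_permutations) (simp add: halves_at_def)
qed

lemma parity_bracket_eq_bracket:
  assumes "framed_4_graph G"
  shows "parity_bracket P G = bracket G {v \<in> verts G. P G v}"
proof -
  let ?W = "{v \<in> verts G. P G v}"
  have "{\<sigma> \<in> {\<sigma>. smoothing_choice G ?W \<sigma>}. num_unicursal (smooth G ?W \<sigma>) = 1}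
      = {\<sigma>. smoothing_choice G ?W \<sigma> \<and> num_unicursal (smooth G ?W \<sigma>) = 1}" by auto
  then show ?thesis
    using sum.inter_filter[OF finite_smoothing_choices[OF assms, of ?W],
        of "\<lambda>\<sigma>. Poly_Mapping.single (abs_knot_graph_mod_R2 (smooth G ?W \<sigma>)) 1"
          "\<lambda>\<sigma>. num_unicursal (smooth G ?W \<sigma>) = 1"]
    by (simp only: parity_bracket_def bracket_def knot_term_def Let_def)
qed

lemma smoothing_choice_splice:
  assumes "W \<inter> V = {}"
  shows "smoothing_choice (splice G (halves_at G W) \<sigma>) V = smoothing_choice G V"
  using assms by (intro ext) (auto simp: smoothing_choice_def disjoint_iff)

lemma sum_smoothing_choice_Un:
  assumes "framed_4_graph G" "W \<inter> V = {}"
  shows "(\<Sum>\<rho> | smoothing_choice G (W \<union> V) \<rho>. F \<rho>)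
    = (\<Sum>\<sigma> | smoothing_choice G W \<sigma>. \<Sum>\<tau> | smoothing_choice G V \<tau>. F (\<sigma> \<circ> \<tau>))"
proof -
  \<comment> \<open>Restriction of a choice to the star of \<open>W\<close>; restricting to
    \<open>W\<close> and to \<open>V\<close> inverts the composition.\<close>
  define on where "on W \<rho> h = (if h \<in> halves_at G W then \<rho> h else h)" for W and \<rho> :: "nat \<Rightarrow> nat" and h
  have "(\<Sum>\<sigma> | smoothing_choice G W \<sigma>. \<Sum>\<tau> | smoothing_choice G V \<tau>. F (\<sigma> \<circ> \<tau>))
      = (\<Sum>(\<sigma>, \<tau>) \<in> {\<sigma>. smoothing_choice G W \<sigma>} \<times> {\<tau>. smoothing_choice G V \<tau>}. F (\<sigma> \<circ> \<tau>))"
    by (rule sum.cartesian_product)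
  also have "\<dots> = (\<Sum>\<rho> | smoothing_choice G (W \<union> V) \<rho>. F \<rho>)"
  proof (rule sum.reindex_bij_witness[where j = "\<lambda>(\<sigma>, \<tau>). \<sigma> \<circ> \<tau>" and i = "\<lambda>\<rho>. (on W \<rho>, on V \<rho>)"], goal_cases)
    case (1 p)
    obtain \<sigma> \<tau> where p: "p = (\<sigma>, \<tau>)" "smoothing_choice G W \<sigma>" "smoothing_choice G V \<tau>" using 1 by auto
    have "on W (\<sigma> \<circ> \<tau>) h = \<sigma> h" "on V (\<sigma> \<circ> \<tau>) h = \<tau> h" for h
      using p(2,3) assms(2) unfolding on_def smoothing_choice_def by (auto simp: disjoint_iff)
    then show ?case using p(1) by (auto simp: fun_eq_iff)
  next
    case (2 p)
    obtain \<sigma> \<tau> where p: "p = (\<sigma>, \<tau>)" "smoothing_choice G W \<sigma>" "smoothing_choice G V \<tau>" using 2 by auto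
    then show ?case using smoothing_choice_comp(3)[OF assms(2)] by simp
  next
    case (3 \<rho>)
    have "(on W \<rho> \<circ> on V \<rho>) h = \<rho> h" for h
      using 3 assms(2) unfolding on_def smoothing_choice_def by (auto simp: disjoint_iff)
    then show ?case by (simp add: fun_eq_iff)
  next
    case (4 \<rho>)
    then show ?case unfolding on_def smoothing_choice_def by (auto simp: disjoint_iff)
  next
    case (5 p)
    then show ?case by auto
  qed
  finally show ?thesis by simp
qed

lemma knot_term_smooth_smooth:
  assumes "framed_4_graph G" "W \<inter> V = {}" "smoothing_choice G W \<sigma>" "smoothing_choice G V \<tau>"
  shows "knot_term (smooth G (W \<union> V) (\<sigma> \<circ> \<tau>)) = knot_term (smooth (smooth G W \<sigma>) V \<tau>)"
proof -
  note t = smoothing_choice_comp(1,2)[OF assms(2-4)]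
  note f = smoothing_choice_fpf[OF assms(3)] smoothing_choice_fpf[OF assms(4)]
  note i = framed_iso_splice_splice[OF assms(1,2) f t]
  have V: "halves_at (splice G (halves_at G W) \<sigma>) V = halves_at G V"
    using assms(2) by auto
  show ?thesis unfolding smooth_def V
    using framed_splice[OF assms(1) i(2)] framed_splice[OF framed_splice[OF assms(1) f(1)], of V \<tau>, unfolded V, OF f(2)]
      i(1) by (rule knot_term_iso)
qed

lemma bracket_Un:
  assumes "framed_4_graph G" "W \<inter> V = {}"
  shows "bracket G (W \<union> V) = (\<Sum>\<sigma> | smoothing_choice G W \<sigma>. bracket (smooth G W \<sigma>) V)"
  unfolding bracket_def sum_smoothing_choice_Un[OF assms]
  by (intro sum.cong refl) (auto simp: smooth_def smoothing_choice_splice[OF assms(2)] 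
      intro!: sum.cong knot_term_smooth_smooth[OF assms, unfolded smooth_def])

lemma framed_smooth:
  "framed_4_graph G \<Longrightarrow> smoothing_choice G W \<sigma> \<Longrightarrow> framed_4_graph (smooth G W \<sigma>)"
  unfolding smooth_def by (intro framed_splice smoothing_choice_fpf)

text \<open>Conjugation by \<open>f\<close> matches the choices on both sides; \<open>push\<close>
  and \<open>pull\<close> are the two directions, extended by the identity as
  \<open>smoothing_choice\<close> demands.\<close>

lemma bracket_iso:
  assumes "framed_4_graph G" "framed_4_graph G'" "framed_iso G G' f g" "W \<subseteq> verts G"
  shows "bracket G' (g ` W) = bracket G W"
proof -
  note I = framed_isoD[OF assms(3)]
  define f' where "f' = inv_into (halves G) f"
  have f': "f' (f h) = h" if "h \<in> halves G" for h using that I(2) by (simp add: f'_def)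
  have R': "halves_at G' (g ` W) = f ` halves_at G W" by (rule halves_at_iso) fact+
  define push where "push \<sigma> h = (if h \<in> halves_at G' (g ` W) then f (\<sigma> (f' h)) else h)" for \<sigma> h
  define pull where "pull \<sigma> h = (if h \<in> halves_at G W then f' (\<sigma> (f h)) else h)" for \<sigma> h
  have push_f: "push \<sigma> (f h) = f (\<sigma> h)" if "h \<in> halves_at G W" for \<sigma> h
    using that f' unfolding push_def R' by auto
  have mem': "\<exists>h\<in>halves_at G W. k = f h" if "k \<in> halves_at G' (g ` W)" for k using that unfolding R' by auto
  have pullpush: "pull (push \<sigma>) = \<sigma>" and push: "smoothing_choice G' (g ` W) (push \<sigma>)"
    if "smoothing_choice G W \<sigma>" for \<sigma>
  proof -
    have c: "\<sigma> h \<in> halves_at G W" "\<sigma> h \<noteq> h" "\<sigma> h \<noteq> opp G h" "\<sigma> (\<sigma> h) = h" if "h \<in> halves_at G W" for h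
      using that \<open>smoothing_choice G W \<sigma>\<close> by (auto simp: smoothing_choice_def)
    show "pull (push \<sigma>) = \<sigma>"
    proof
      fix h
      show "pull (push \<sigma>) h = \<sigma> h"
        using that push_f[of h \<sigma>] f'[of "\<sigma> h"] c(1)[of h] by (auto simp: pull_def smoothing_choice_def)
    qed
    have "push \<sigma> k \<in> halves_at G' (g ` W) \<and> vert G' (push \<sigma> k) = vert G' k \<and> push \<sigma> k \<noteq> k \<and>
        push \<sigma> k \<noteq> opp G' k \<and> push \<sigma> (push \<sigma> k) = k" if k: "k \<in> halves_at G' (g ` W)" for k
    proof -
      obtain h where h: "h \<in> halves_at G W" "k = f h" using mem'[OF k] by blast
      have hh: "h \<in> halves G" "\<sigma> h \<in> halves G" "opp G h \<in> halves G" "vert G (\<sigma> h) = vert G h"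
        using h c[OF h(1)] framed_4_graphD[OF assms(1)] that \<open>smoothing_choice G W \<sigma>\<close> 
        by (auto simp: smoothing_choice_def)
      have "f (\<sigma> h) \<in> halves_at G' (g ` W)" unfolding R' using c(1)[OF h(1)] by (rule imageI)
      moreover have "f (\<sigma> h) \<noteq> f h" "f (\<sigma> h) \<noteq> f (opp G h)"
        using I(2) hh c[OF h(1)] by (metis inj_onD)+
      ultimately show ?thesis
        using push_f[OF h(1)] push_f[OF c(1)[OF h(1)]] c(4)[OF h(1)] I(5,6) hh h(2) by simp
    qed
    then show "smoothing_choice G' (g ` W) (push \<sigma>)"
      by (rule smoothing_choiceI) (auto simp: push_def)
  qed
  have pushpull: "push (pull \<sigma>) = \<sigma>" and pull: "smoothing_choice G W (pull \<sigma>)"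
    if "smoothing_choice G' (g ` W) \<sigma>" for \<sigma>
  proof -
    have c: "\<sigma> k \<in> halves_at G' (g ` W)" "\<sigma> k \<noteq> k" "\<sigma> k \<noteq> opp G' k" "\<sigma> (\<sigma> k) = k" "vert G' (\<sigma> k) = vert G' k"
      if "k \<in> halves_at G' (g ` W)" for k
      using that \<open>smoothing_choice G' (g ` W) \<sigma>\<close> by (auto simp: smoothing_choice_def)
    have *: "pull \<sigma> h \<in> halves_at G W \<and> f (pull \<sigma> h) = \<sigma> (f h)" if h: "h \<in> halves_at G W" for h
    proof -
      have "f h \<in> halves_at G' (g ` W)" unfolding R' using h by (rule imageI)
      from mem'[OF c(1)[OF this]] obtain k where "k \<in> halves_at G W" "\<sigma> (f h) = f k" by blast
      then show ?thesis using h f' by (simp add: pull_def)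
    qed
    show "push (pull \<sigma>) = \<sigma>"
    proof
      fix k
      show "push (pull \<sigma>) k = \<sigma> k"
      proof (cases "k \<in> halves_at G' (g ` W)")
        case True
        then show ?thesis using mem' push_f * by metis
      next
        case False
        then show ?thesis using that by (auto simp: push_def smoothing_choice_def)
      qed
    qed
    have "pull \<sigma> h \<in> halves_at G W \<and> vert G (pull \<sigma> h) = vert G h \<and> pull \<sigma> h \<noteq> h \<and>
        pull \<sigma> h \<noteq> opp G h \<and> pull \<sigma> (pull \<sigma> h) = h" if h: "h \<in> halves_at G W" for h
    proof -
      have fh: "f h \<in> halves_at G' (g ` W)" unfolding R' using h by (rule imageI)
      have h1: "h \<in> halves G" "pull \<sigma> h \<in> halves G" "opp G h \<in> halves G" "pull \<sigma> h \<in> halves_at G W"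
        using h *[OF h] framed_4_graphD[OF assms(1)] by auto
      have "g (vert G (pull \<sigma> h)) = g (vert G h)" using c(5)[OF fh] I(5) h1 *[OF h] by metis
      then have "vert G (pull \<sigma> h) = vert G h"
        using I(4) h1(1,2) unfolding verts_def by (metis imageI inj_onD)
      moreover have "pull \<sigma> h \<noteq> h" "pull \<sigma> h \<noteq> opp G h"
        using c[OF fh] *[OF h] I(6) h1(1) by metis+
      moreover have "f (pull \<sigma> (pull \<sigma> h)) = f h" "pull \<sigma> (pull \<sigma> h) \<in> halves G"
        using *[OF h] *[OF h1(4)] c(4)[OF fh] by auto
      then have "pull \<sigma> (pull \<sigma> h) = h" using I(2) h1(1) by (metis inj_onD)
      ultimately show ?thesis using h1 by simp
    qed
    then show "smoothing_choice G W (pull \<sigma>)"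
      by (rule smoothing_choiceI) (auto simp: pull_def)
  qed
  have kt: "knot_term (smooth G' (g ` W) (push \<sigma>)) = knot_term (smooth G W \<sigma>)" if "smoothing_choice G W \<sigma>" for \<sigma>
    using knot_term_iso[OF framed_smooth[OF assms(1) that] framed_smooth[OF assms(2) push[OF that]]]
      framed_iso_splice[OF assms smoothing_choice_fpf[OF that], of "push \<sigma>"] push_f
    by (simp add: smooth_def)
  show ?thesis unfolding bracket_def
    by (rule sum.reindex_bij_witness[where i = push and j = pull])
       (use pushpull pullpush push pull kt in auto, metis)
qed

subsection \<open>The first two moves\<close>

text \<open>Gluings of the same half-edges with equal summaries give isomorphic splices; see
  \<open>knot_term_splice_cong\<close>.\<close>

definition summary :: "'a set \<Rightarrow> ('a \<Rightarrow> 'a) \<Rightarrow> 'a set \<Rightarrow> ('a \<Rightarrow> 'a) \<Rightarrow> ('a \<times> 'a) set \<times> nat" where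
  "summary H j R s = (ends H j R s, card (loops H j R s))"

text \<open>The involution that \<open>contract\<close> leaves after contracting the edge with
  halves \<open>a\<close> and \<open>b\<close>. Being an explicit function update, it can be
  evaluated by rewriting.\<close>

definition pull :: "'a \<Rightarrow> 'a \<Rightarrow> ('a \<Rightarrow> 'a) \<Rightarrow> 'a \<Rightarrow> 'a" where
  "pull a b s = s(s a := s b, s b := s a)"

definition swap2 :: "'a \<Rightarrow> 'a \<Rightarrow> 'a \<Rightarrow> 'a \<Rightarrow> 'a \<Rightarrow> 'a" where
  "swap2 a b c d = id(a := b, b := a, c := d, d := c)"

lemma pull_apply:
  "pull a b s x = (if x = s b then s a else if x = s a then s b else s x)"
  by (simp add: pull_def)

lemma swap2_apply:
  "swap2 a b c d x = (if x = d then c else if x = c then d else if x = b then a else if x = a then b else x)"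
  by (simp add: swap2_def)

lemma summary_cong:
  assumes "\<And>h. h \<in> R \<Longrightarrow> s h = s' h"
  shows "summary H j R s = summary H j R s'"
  using paths_cong[of H j j R s s'] assms by (simp add: summary_def ends_def loops_def)

lemma summary_pull:
  assumes "gluing H j R s" "a \<in> R" "b \<in> R" "j a = b" "s a \<noteq> b"
  shows "summary H j R s = summary (H - {a, b}) j (R - {a, b}) (pull a b s)"
    and "gluing (H - {a, b}) j (R - {a, b}) (pull a b s)"
  using gluing.contract[OF assms(1), of a] assms(2-) by (auto simp: summary_def pull_def)

text \<open>The graphs may differ in \<open>vert\<close> and \<open>opp\<close> on the spliced star.
  This freedom serves the third move, whose two sides differ exactly there in the chosen
  model.\<close>

lemma knot_term_splice_cong:
  assumes "framed_4_graph G" "framed_4_graph G'"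
    and "halves G' = halves G" "join G' = join G" "circles G' = circles G"
    and "halves_at G' W' = halves_at G W"
    and "fpf_involution (halves_at G W) \<sigma>" "fpf_involution (halves_at G W) \<sigma>'"
    and "\<And>h. h \<in> halves G - halves_at G W \<Longrightarrow> vert G h = vert G' h \<and> opp G h = opp G' h"
    and "summary (halves G) (join G) (halves_at G W) \<sigma> = summary (halves G) (join G) (halves_at G W) \<sigma>'"
  shows "knot_term (splice G (halves_at G W) \<sigma>) = knot_term (splice G' (halves_at G' W') \<sigma>')"
proof (rule knot_term_iso)
  show "framed_4_graph (splice G (halves_at G W) \<sigma>)" by (rule framed_splice) fact+
  show "framed_4_graph (splice G' (halves_at G' W') \<sigma>')"
    by (rule framed_splice) (use assms(2,6,8) in simp_all)
  show "framed_iso (splice G (halves_at G W) \<sigma>) (splice G' (halves_at G' W') \<sigma>') id id"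
    unfolding assms(6) by (rule framed_iso_splice_id) (use assms(3-5,9,10) in \<open>auto simp: summary_def\<close>)
qed

text \<open>\<open>E\<close> carries a closed part of the spliced curve while \<open>y\<close> lies
  off it, so there are at least two components.\<close>

lemma knot_term_splice_loop:
  assumes "framed_4_graph G" "fpf_involution (halves_at G W) \<sigma>"
    and "E \<subseteq> halves_at G W" "x \<in> E" "y \<in> halves G" "y \<notin> E"
    and "\<And>h. h \<in> E \<Longrightarrow> join G h \<in> E" "\<And>h. h \<in> E \<Longrightarrow> \<sigma> h \<in> E"
  shows "knot_term (splice G (halves_at G W) \<sigma>) = 0"
proof -
  define t where "t h = (if h \<in> halves_at G W then \<sigma> h else opp G h)" for h
  have t: "h \<in> halves_at G W \<Longrightarrow> t h = \<sigma> h" "h \<in> halves G - halves_at G W \<Longrightarrow> t h = opp G h" for h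
    by (auto simp: t_def)
  note n = num_unicursal_splice[OF assms(1,2) t]
  have E: "E \<subseteq> halves G" using assms(3) by auto
  have "t h \<in> E" if "h \<in> E" for h using that t(1)[of h] assms(3,8) by auto
  then have "card (loops (halves G) (join G) (halves G) t) \<ge> 2"
    using two_loops[OF n(2) E assms(4) _ assms(7)] assms(5,6) by blast
  then have "num_unicursal (splice G (halves_at G W) \<sigma>) \<noteq> 1" using n(1) by simp
  then show ?thesis by (simp add: knot_term_def)
qed

lemma vertex_star:
  assumes "framed_4_graph G" "a \<in> halves_at G {v}" "a' \<in> halves_at G {v}" "a \<noteq> a'" "a' \<noteq> opp G a"
  shows "halves_at G {v} = {a, a', opp G a, opp G a'}" "distinct [a, a', opp G a, opp G a']"
proof -
  note F = framed_4_graphD[OF assms(1)]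
  have h: "a \<in> halves G" "a' \<in> halves G" "vert G a = v" "vert G a' = v" using assms by auto
  have "opp G a' \<noteq> a" "opp G a \<noteq> opp G a'" using F(6) h assms(4,5) by metis+
  then show d: "distinct [a, a', opp G a, opp G a']"
    using F(5)[OF h(1)] F(5)[OF h(2)] assms(4,5) by auto
  have "card {a, a', opp G a, opp G a'} = 4" using distinct_card[OF d] by simp
  moreover have "card (halves_at G {v}) = 4"
    using assms(1) h by (auto simp: framed_4_graph_def verts_def)
  moreover have "finite (halves_at G {v})" using F(1) by (simp add: halves_at_def)
  ultimately show "halves_at G {v} = {a, a', opp G a, opp G a'}"
    using card_subset_eq[of "halves_at G {v}" "{a, a', opp G a, opp G a'}"] F(4,7) h by auto
qed

text \<open>The partner of \<open>a\<close> is \<open>a'\<close> or \<open>opp G a'\<close>, and it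
  determines the rest. In the applications \<open>a\<close> and \<open>a'\<close> belong to the
  loop, bigon or triangle of the move: \<open>s\<close> cuts this corner off, \<open>t\<close> leads
  out of it.\<close>

lemma sum_smoothing_choice_vertex:
  assumes "framed_4_graph G" "a \<in> halves_at G {v}" "a' \<in> halves_at G {v}" "a \<noteq> a'" "a' \<noteq> opp G a"
  defines "s \<equiv> swap2 a a' (opp G a) (opp G a')" and "t \<equiv> swap2 a (opp G a') a' (opp G a)"
  shows "(\<Sum>\<sigma> | smoothing_choice G {v} \<sigma>. F \<sigma>) = F s + F t"
    and "smoothing_choice G {v} s" "smoothing_choice G {v} t"
proof -
  note F = framed_4_graphD[OF assms(1)]
  note star = vertex_star[OF assms(1-5)]
  have h: "a \<in> halves G" "a' \<in> halves G" "opp G a \<in> halves G" "opp G a' \<in> halves G"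
    "vert G a = v" "vert G a' = v" "vert G (opp G a) = v" "vert G (opp G a') = v"
    "opp G (opp G a) = a" "opp G (opp G a') = a'"
    using assms F(4,6,7) by auto
  have d: "a \<noteq> a'" "a \<noteq> opp G a" "a \<noteq> opp G a'" "a' \<noteq> opp G a" "a' \<noteq> opp G a'" "opp G a \<noteq> opp G a'"
    "a' \<noteq> a" "opp G a \<noteq> a" "opp G a' \<noteq> a" "opp G a \<noteq> a'" "opp G a' \<noteq> a'" "opp G a' \<noteq> opp G a"
    using star(2) by auto
  show s: "smoothing_choice G {v} s" and t: "smoothing_choice G {v} t"
    by (rule smoothing_choiceI; unfold star(1); auto simp: s_def t_def swap2_def d h)+
  have "\<sigma> = s \<or> \<sigma> = t" if "smoothing_choice G {v} \<sigma>" for \<sigma>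
  proof -
    have *: "\<sigma> k \<in> {a, a', opp G a, opp G a'} - {k, opp G k} \<and> \<sigma> (\<sigma> k) = k"
      if "k \<in> {a, a', opp G a, opp G a'}" for k
    proof -
      have k: "k \<in> halves_at G {v}" unfolding star(1) by (fact that)
      have "\<sigma> k \<in> halves_at G {v}" "\<sigma> k \<noteq> k" "\<sigma> k \<noteq> opp G k" "\<sigma> (\<sigma> k) = k"
        using smoothing_choiceD(1)[OF \<open>smoothing_choice G {v} \<sigma>\<close>, of k] k by simp_all
      then show ?thesis unfolding star(1) by blast
    qed
    have out: "\<sigma> k = k" if "k \<notin> {a, a', opp G a, opp G a'}" for k
      using smoothing_choiceD(2)[OF \<open>smoothing_choice G {v} \<sigma>\<close>, of k] that unfolding star(1) by blast
    have "\<sigma> a = a' \<or> \<sigma> a = opp G a'" using *[of a] by auto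
    then show ?thesis
    proof
      assume 1: "\<sigma> a = a'"
      then have "\<sigma> a' = a" using *[of a] by auto
      moreover then have "\<sigma> (opp G a) = opp G a'" using *[of "opp G a"] h(9) d by auto
      moreover then have "\<sigma> (opp G a') = opp G a" using *[of "opp G a"] by auto
      ultimately have "\<sigma> = s" using 1 out by (auto simp: s_def swap2_def fun_eq_iff)
      then show ?thesis ..
    next
      assume 1: "\<sigma> a = opp G a'"
      then have "\<sigma> (opp G a') = a" using *[of a] by auto
      moreover then have "\<sigma> a' = opp G a" using *[of a'] d 1 by auto
      moreover then have "\<sigma> (opp G a) = a'" using *[of a'] by auto
      ultimately have "\<sigma> = t" using 1 out by (auto simp: t_def swap2_def fun_eq_iff)
      then show ?thesis ..
    qed
  qed
  then have "{\<sigma>. smoothing_choice G {v} \<sigma>} = {s, t}" using s t by auto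
  moreover have "s \<noteq> t" using d by (auto simp: s_def t_def swap2_def fun_eq_iff)
  ultimately show "(\<Sum>\<sigma> | smoothing_choice G {v} \<sigma>. F \<sigma>) = F s + F t" by simp
qed

lemma bracket_R1:
  assumes G: "framed_4_graph G"
    and a: "a \<in> halves G" "vert G a = v" "vert G (join G a) = v" "join G a \<noteq> opp G a"
  shows "bracket G {v} = knot_term (splice G (halves_at G {v}) (opp G))"
proof -
  note F = framed_4_graphD[OF G]
  define b where "b = join G a"
  have ab: "a \<in> halves_at G {v}" "b \<in> halves_at G {v}" "a \<noteq> b" "b \<noteq> opp G a"
    using a F(8,9)[OF a(1)] by (auto simp: b_def)
  have jb: "join G a = b" "join G b = a" using a(1) F(10) by (auto simp: b_def)
  note star = vertex_star[OF G ab]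
  define A B where "A = opp G a" and "B = opp G b"
  have opp: "opp G a = A" "opp G b = B" "opp G A = a" "opp G B = b"
    using F(6) ab by (auto simp: A_def B_def)
  define R where "R = halves_at G {v}"
  have R: "R = {a, b, A, B}" and d: "distinct [a, b, A, B]"
    using star by (simp_all add: R_def A_def B_def)
  have AH: "A \<in> halves G" using F(4) a(1) by (simp add: A_def)
  define s t where "s = swap2 a b A B" and "t = swap2 a B b A"
  note V = sum_smoothing_choice_vertex[OF G ab, folded A_def B_def, folded s_def t_def]
  have fpf: "fpf_involution R s" "fpf_involution R t" "fpf_involution R (opp G)"
    using smoothing_choice_fpf V(2,3) F(3) by (auto simp: R_def)
  have g: "gluing (halves G) (join G) R \<sigma>" if "fpf_involution R \<sigma>" for \<sigma>
    using framed_gluing[OF G] that by (simp add: R_def)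
  \<comment> \<open>\<open>s\<close> glues the two halves of the loop to each other, which splits
    off a circle.\<close>
  have "knot_term (splice G R s) = 0"
    unfolding R_def
    by (rule knot_term_splice_loop[OF G, where E = "{a, b}" and x = a and y = A])
       (use fpf R d AH jb in \<open>auto simp: R_def[symmetric] s_def swap2_def\<close>)
  \<comment> \<open>After contraction of the loop, both \<open>t\<close> and \<open>opp G\<close>
    glue \<open>A\<close> to \<open>B\<close>.\<close>
  moreover have "summary (halves G) (join G) R t = summary (halves G) (join G) R (opp G)"
  proof -
    have ne: "t a \<noteq> b" "opp G a \<noteq> b" using d opp by (auto simp: t_def swap2_def)
    have ab': "a \<in> R" "b \<in> R" by (auto simp: R)
    show ?thesis
      unfolding summary_pull(1)[OF g[OF fpf(2)] ab' jb(1) ne(1)] summary_pull(1)[OF g[OF fpf(3)] ab' jb(1) ne(2)]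
      by (rule summary_cong) (use d in \<open>auto simp: R pull_def t_def swap2_def opp\<close>)
  qed
  then have "knot_term (splice G R t) = knot_term (splice G R (opp G))"
    unfolding R_def by (intro knot_term_splice_cong[OF G G]) (use fpf in \<open>auto simp: R_def\<close>)
  ultimately show ?thesis by (simp add: bracket_def smooth_def R_def V(1))
qed

lemma bracket_R2:
  assumes G: "framed_4_graph G" and uv: "u \<noteq> v"
    and ab: "a \<in> halves_at G {u}" "b \<in> halves_at G {u}" "a \<noteq> b" "b \<noteq> opp G a"
    and v: "vert G (join G a) = v" "vert G (join G b) = v" "join G b \<noteq> opp G (join G a)"
  shows "bracket G {u, v} = knot_term (splice G (halves_at G {u, v}) (opp G))"
proof -
  note F = framed_4_graphD[OF G]
  define a' b' where "a' = join G a" and "b' = join G b"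
  have ab': "a' \<in> halves_at G {v}" "b' \<in> halves_at G {v}" "a' \<noteq> b'" "b' \<noteq> opp G a'"
    using ab v F(8) F(10)[of a] F(10)[of b] by (auto simp: a'_def b'_def)
  have j: "join G a = a'" "join G b = b'" "join G a' = a" "join G b' = b"
    using ab F(10) by (auto simp: a'_def b'_def)
  define A B A' B' where "A = opp G a" and "B = opp G b" and "A' = opp G a'" and "B' = opp G b'"
  note AB = A_def[symmetric] B_def[symmetric] A'_def[symmetric] B'_def[symmetric]
  have opp: "opp G a = A" "opp G b = B" "opp G A = a" "opp G B = b"
     "opp G a' = A'" "opp G b' = B'" "opp G A' = a'" "opp G B' = b'"
    using F(6) ab ab' by (auto simp: A_def B_def A'_def B'_def)
  note star = vertex_star[OF G ab, unfolded AB] vertex_star[OF G ab', unfolded AB]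
  define R where "R = halves_at G {u, v}"
  have "R = halves_at G {u} \<union> halves_at G {v}" "halves_at G {u} \<inter> halves_at G {v} = {}"
    using uv by (auto simp: R_def)
  then have R: "R = {a, b, A, B, a', b', A', B'}" and d: "distinct [a, b, A, B, a', b', A', B']"
    using star by auto
  then have d': "distinct [B', A', b', a', B, A, b, a]" by auto
  define s t s' t' where "s = swap2 a b A B" and "t = swap2 a B b A"
    and "s' = swap2 a' b' A' B'" and "t' = swap2 a' B' b' A'"
  note V = sum_smoothing_choice_vertex[OF G ab, unfolded AB, folded s_def t_def]
  note V' = sum_smoothing_choice_vertex[OF G ab', unfolded AB, folded s'_def t'_def]
  have uv': "{u} \<inter> {v} = {}" "{u} \<union> {v} = {u, v}" using uv by auto
  define Q where "Q \<sigma> = knot_term (splice G R \<sigma>)" for \<sigma>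
  have "bracket G {u, v} = Q (s \<circ> s') + Q (s \<circ> t') + (Q (t \<circ> s') + Q (t \<circ> t'))"
    unfolding bracket_def smooth_def Q_def R_def
      sum_smoothing_choice_Un[OF G uv'(1), unfolded uv'(2)] V(1) V'(1) ..
  moreover have fpf: "fpf_involution R (s \<circ> s')" "fpf_involution R (s \<circ> t')"
      "fpf_involution R (t \<circ> s')" "fpf_involution R (t \<circ> t')" "fpf_involution R (opp G)"
    using smoothing_choice_comp(3)[OF uv'(1)] V(2,3) V'(2,3) smoothing_choice_fpf F(3)
    unfolding R_def uv'(2) by metis+
  have g: "gluing (halves G) (join G) R \<sigma>" if "fpf_involution R \<sigma>" for \<sigma>
    using framed_gluing[OF G] that by (simp add: R_def)
  \<comment> \<open>Contracting the two bigon edges leaves a pairing of the outer half-edges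
    \<open>A\<close>, \<open>B\<close>, \<open>A'\<close>, \<open>B'\<close>, on which alone the
    splice depends. The inequalities say that neither edge closes up on the way.\<close>
  have Q_cong: "Q \<sigma> = Q \<sigma>'"
    if "fpf_involution R \<sigma>" "fpf_involution R \<sigma>'" "\<sigma> a \<noteq> a'" "\<sigma>' a \<noteq> a'"
      "pull a a' \<sigma> b \<noteq> b'" "pull a a' \<sigma>' b \<noteq> b'"
      "\<forall>h\<in>{A, B, A', B'}. pull b b' (pull a a' \<sigma>) h = pull b b' (pull a a' \<sigma>') h"
    for \<sigma> \<sigma>'
  proof -
    have m: "a \<in> R" "a' \<in> R" "b \<in> R - {a, a'}" "b' \<in> R - {a, a'}" using d by (auto simp: R)
    note c = summary_pull[OF g[OF that(1)] m(1,2) j(1) that(3)] 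
    note c' = summary_pull[OF g[OF that(2)] m(1,2) j(1) that(4)]
    have "summary (halves G) (join G) R \<sigma> = summary (halves G) (join G) R \<sigma>'"
      unfolding c(1) c'(1) summary_pull(1)[OF c(2) m(3,4) j(2) that(5)]
        summary_pull(1)[OF c'(2) m(3,4) j(2) that(6)]
      by (rule summary_cong, rule that(7)[rule_format]) (use d in \<open>auto simp: R\<close>)
    then show ?thesis
      unfolding Q_def R_def by (intro knot_term_splice_cong[OF G G]) (use that in \<open>auto simp: R_def\<close>)
  qed
  note eval = swap2_apply pull_apply comp_apply s_def t_def s'_def t'_def
  have "Q (s \<circ> s') = 0"
    unfolding Q_def R_def
  proof (rule knot_term_splice_loop[OF G, where E = "{a, b, a', b'}" and x = a and y = A])
    show "fpf_involution (halves_at G {u, v}) (s \<circ> s')" using fpf(1) by (simp only: R_def)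
    show "{a, b, a', b'} \<subseteq> halves_at G {u, v}" unfolding R_def[symmetric] R by blast
    show "A \<notin> {a, b, a', b'}" using d by auto
    show "A \<in> halves G" using F(4) ab(1) by (simp add: A_def)
    show "join G h \<in> {a, b, a', b'}" if "h \<in> {a, b, a', b'}" for h
      using that j by auto
    show "(s \<circ> s') h \<in> {a, b, a', b'}" if "h \<in> {a, b, a', b'}" for h
      using that d by (auto simp: eval)
  qed simp
  \<comment> \<open>The two cancelling terms: both pair \<open>A\<close> with \<open>B\<close> and
    \<open>A'\<close> with \<open>B'\<close>.\<close>
  moreover have "Q (s \<circ> t') = Q (t \<circ> s')"
    by (rule Q_cong) (fact fpf, fact fpf, use d d' in \<open>simp_all add: eval\<close>)
  \<comment> \<open>Both pair \<open>A\<close> with \<open>A'\<close> and \<open>B\<close> with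
    \<open>B'\<close>.\<close>
  moreover have "Q (t \<circ> t') = Q (opp G)"
    by (rule Q_cong) (fact fpf, fact fpf, use d d' in \<open>simp_all add: eval opp\<close>)
  ultimately show ?thesis by (simp add: Q_def R_def)
qed

subsection \<open>The third move\<close>

definition swap3 :: "'a \<Rightarrow> 'a \<Rightarrow> 'a \<Rightarrow> 'a \<Rightarrow> 'a \<Rightarrow> 'a \<Rightarrow> 'a \<Rightarrow> 'a" where
  "swap3 a b c d e f = id(a := b, b := a, c := d, d := c, e := f, f := e)"

lemma swap3_apply:
  "swap3 a b c d e f x = (if x = f then e else if x = e then f else if x = d then c else
    if x = c then d else if x = b then a else if x = a then b else x)"
  by (simp add: swap3_def)

text \<open>Capitals denote the half-edges leading out of the triangle. They are parameters, not
  terms \<open>opp G a1\<close>, so that the graph after the move is an instance of the same locale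
  with only the capitals permuted.\<close>

locale triangle =
  fixes G :: framed_graph and u v w a1 a2 b1 b2 c1 c2 A1 A2 B1 B2 C1 C2 :: nat
  assumes framed: "framed_4_graph G" and uvw: "distinct [u, v, w]"
    and at_u: "a1 \<in> halves_at G {u}" "a2 \<in> halves_at G {u}" "a1 \<noteq> a2" "a2 \<noteq> opp G a1"
    and at_v: "b1 \<in> halves_at G {v}" "b2 \<in> halves_at G {v}" "b1 \<noteq> b2" "b2 \<noteq> opp G b1"
    and at_w: "c1 \<in> halves_at G {w}" "c2 \<in> halves_at G {w}" "c1 \<noteq> c2" "c2 \<noteq> opp G c1"
    and joins: "join G a1 = b1" "join G b2 = c1" "join G c2 = a2"
    and opps: "opp G a1 = A1" "opp G a2 = A2" "opp G b1 = B1" "opp G b2 = B2"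
      "opp G c1 = C1" "opp G c2 = C2"
begin

abbreviation "su \<equiv> swap2 a1 a2 A1 A2"
abbreviation "tu \<equiv> swap2 a1 A2 a2 A1"
abbreviation "sv \<equiv> swap2 b1 b2 B1 B2"
abbreviation "tv \<equiv> swap2 b1 B2 b2 B1"
abbreviation "sw \<equiv> swap2 c1 c2 C1 C2"
abbreviation "tw \<equiv> swap2 c1 C2 c2 C1"
abbreviation "R \<equiv> halves_at G {u, v, w}"
abbreviation "E \<equiv> {a1, b1, b2, c1, c2, a2}"

lemma stars: "halves_at G {u} = {a1, a2, A1, A2}" "halves_at G {v} = {b1, b2, B1, B2}"
  "halves_at G {w} = {c1, c2, C1, C2}"
  using vertex_star(1)[OF framed at_u] vertex_star(1)[OF framed at_v] vertex_star(1)[OF framed at_w]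
  unfolding opps by auto

lemma R: "R = {a1, a2, A1, A2, b1, b2, B1, B2, c1, c2, C1, C2}"
proof -
  have "R = halves_at G {u} \<union> halves_at G {v} \<union> halves_at G {w}" by auto
  then show ?thesis unfolding stars by auto
qed

lemma distinct_halves: "distinct [a1, a2, A1, A2, b1, b2, B1, B2, c1, c2, C1, C2]"
proof -
  have "halves_at G {u} \<inter> halves_at G {v} = {}" "halves_at G {u} \<inter> halves_at G {w} = {}"
    "halves_at G {v} \<inter> halves_at G {w} = {}"
    using uvw by auto
  then show ?thesis
    unfolding stars using vertex_star(2)[OF framed at_u] vertex_star(2)[OF framed at_v] vertex_star(2)[OF framed at_w]
    unfolding opps by auto
qed

text \<open>The simplifier does not derive \<open>y \<noteq> x\<close> from \<open>x \<noteq> y\<close>.\<close>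

lemma distinct_halves_rev: "distinct [C2, C1, c2, c1, B2, B1, b2, b1, A2, A1, a2, a1]"
  using distinct_halves by auto

lemma in_halves [simp]: "a1 \<in> halves G" "a2 \<in> halves G" "b1 \<in> halves G" "b2 \<in> halves G"
  "c1 \<in> halves G" "c2 \<in> halves G" "A1 \<in> halves G" "A2 \<in> halves G" "B1 \<in> halves G"
  "B2 \<in> halves G" "C1 \<in> halves G" "C2 \<in> halves G"
  using R halves_at_iff[of _ G "{u, v, w}"] by blast+

lemma vert_simps [simp]: "vert G a1 = u" "vert G a2 = u" "vert G A1 = u" "vert G A2 = u"
  "vert G b1 = v" "vert G b2 = v" "vert G B1 = v" "vert G B2 = v"
  "vert G c1 = w" "vert G c2 = w" "vert G C1 = w" "vert G C2 = w"
  using stars halves_at_iff[of _ G "{u}"] halves_at_iff[of _ G "{v}"] halves_at_iff[of _ G "{w}"] by blast+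

lemma opp_simps [simp]: "opp G a1 = A1" "opp G a2 = A2" "opp G A1 = a1" "opp G A2 = a2"
  "opp G b1 = B1" "opp G b2 = B2" "opp G B1 = b1" "opp G B2 = b2"
  "opp G c1 = C1" "opp G c2 = C2" "opp G C1 = c1" "opp G C2 = c2"
  using framed_4_graphD(6)[OF framed] opps in_halves by metis+

lemma join_simps [simp]: "join G a1 = b1" "join G b1 = a1" "join G b2 = c1" "join G c1 = b2"
  "join G c2 = a2" "join G a2 = c2"
  using framed_4_graphD(10)[OF framed] joins in_halves by metis+

lemma gluing_R: "fpf_involution R f \<Longrightarrow> gluing (halves G) (join G) R f"
  by (rule framed_gluing[OF framed])

lemma choices:
  "smoothing_choice G {u} su" "smoothing_choice G {u} tu" "smoothing_choice G {v} sv"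
  "smoothing_choice G {v} tv" "smoothing_choice G {w} sw" "smoothing_choice G {w} tw"
  using sum_smoothing_choice_vertex(2,3)[OF framed at_u] sum_smoothing_choice_vertex(2,3)[OF framed at_v]
    sum_smoothing_choice_vertex(2,3)[OF framed at_w] by (simp_all add: opps)

lemma sum_choices: "(\<Sum>\<sigma> | smoothing_choice G {u} \<sigma>. F \<sigma>) = F su + F tu"
  "(\<Sum>\<sigma> | smoothing_choice G {v} \<sigma>. F \<sigma>) = F sv + F tv"
  "(\<Sum>\<sigma> | smoothing_choice G {w} \<sigma>. F \<sigma>) = F sw + F tw"
  using sum_smoothing_choice_vertex(1)[OF framed at_u] sum_smoothing_choice_vertex(1)[OF framed at_v]
    sum_smoothing_choice_vertex(1)[OF framed at_w] by (simp_all add: opps)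

lemma fpf_R:
  assumes "smoothing_choice G {u} x" "smoothing_choice G {v} y" "smoothing_choice G {w} z"
  shows "fpf_involution R (x \<circ> (y \<circ> z))"
proof -
  have "{v} \<inter> {w} = {}" "{u} \<inter> ({v} \<union> {w}) = {}" using uvw by auto
  from smoothing_choice_comp(3)[OF this(2) assms(1) smoothing_choice_comp(3)[OF this(1) assms(2,3)]]
  have "smoothing_choice G {u, v, w} (x \<circ> (y \<circ> z))" by (simp add: insert_commute)
  then show ?thesis by (rule smoothing_choice_fpf)
qed

lemma bracket_eq:
  defines "Q \<equiv> \<lambda>\<sigma>. knot_term (splice G R \<sigma>)"
  shows "bracket G {u, v, w} =
    Q (su \<circ> (sv \<circ> sw)) + Q (su \<circ> (sv \<circ> tw)) + (Q (su \<circ> (tv \<circ> sw)) + Q (su \<circ> (tv \<circ> tw))) +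
    (Q (tu \<circ> (sv \<circ> sw)) + Q (tu \<circ> (sv \<circ> tw)) + (Q (tu \<circ> (tv \<circ> sw)) + Q (tu \<circ> (tv \<circ> tw))))"
proof -
  have V: "{v} \<inter> {w} = {}" "{u} \<inter> ({v} \<union> {w}) = {}" "{u, v, w} = {u} \<union> ({v} \<union> {w})" using uvw by auto
  have "bracket G {u, v, w} = (\<Sum>\<sigma> | smoothing_choice G ({u} \<union> ({v} \<union> {w})) \<sigma>. Q \<sigma>)"
    unfolding bracket_def smooth_def Q_def V(3) ..
  then show ?thesis
    unfolding sum_smoothing_choice_Un[OF framed V(2)] sum_smoothing_choice_Un[OF framed V(1)] sum_choices .
qed

text \<open>Contract the three triangle edges in turn; what remains is a pairing \<open>p\<close> of
  the six outer half-edges. The inequalities exclude an edge that closes up. The last one fails when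
  all three corners are cut off, a case left to \<open>knot_term_sss\<close>.\<close>

lemma summary_triangle:
  assumes "fpf_involution R f" "f a1 \<noteq> b1" "pull a1 b1 f b2 \<noteq> c1"
    "pull b2 c1 (pull a1 b1 f) c2 \<noteq> a2"
    and p: "\<forall>h\<in>{A1, A2, B1, B2, C1, C2}. pull c2 a2 (pull b2 c1 (pull a1 b1 f)) h = p h"
  shows "summary (halves G) (join G) R f = summary (halves G - E) (join G) (R - E) p"
proof -
  have m: "a1 \<in> R" "b1 \<in> R" "b2 \<in> R - {a1, b1}" "c1 \<in> R - {a1, b1}"
    "c2 \<in> R - {a1, b1} - {b2, c1}" "a2 \<in> R - {a1, b1} - {b2, c1}"
    using distinct_halves by (auto simp: R)
  note s1 = summary_pull[OF gluing_R[OF assms(1)] m(1,2) join_simps(1) assms(2)]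
  note s2 = summary_pull[OF s1(2) m(3,4) join_simps(3) assms(3)]
  note s3 = summary_pull(1)[OF s2(2) m(5,6) join_simps(5) assms(4)]
  have X: "X - {a1, b1} - {b2, c1} - {c2, a2} = X - E" for X by auto
  have "summary (halves G) (join G) R f =
      summary (halves G - E) (join G) (R - E) (pull c2 a2 (pull b2 c1 (pull a1 b1 f)))"
    unfolding s1(1) s2(1) s3 X ..
  also have "\<dots> = summary (halves G - E) (join G) (R - E) p"
    by (rule summary_cong, rule p[rule_format]) (auto simp: R)
  finally show ?thesis .
qed

text \<open>The letters give the smoothings at \<open>u\<close>, \<open>v\<close>, \<open>w\<close>.
  With a single \<open>t\<close> the path enters at that vertex, runs once around the triangle and
  leaves at the same vertex; the other two vertices pair their outer half-edges directly. Hence one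
  result for all three positions of \<open>t\<close>.\<close>

lemma summary_tss:
  "summary (halves G) (join G) R (tu \<circ> (sv \<circ> sw)) = summary (halves G - E) (join G) (R - E) (swap3 A1 A2 B1 B2 C1 C2)"
proof -
  define f where "f = tu \<circ> (sv \<circ> sw)"
  have f: "f a1 = A2" "f A2 = a1" "f a2 = A1" "f A1 = a2" "f b1 = b2" "f b2 = b1" "f B1 = B2" "f B2 = B1" "f c1 = c2" "f c2 = c1" "f C1 = C2" "f C2 = C1"
    using distinct_halves distinct_halves_rev unfolding f_def by (simp_all add: swap2_apply)
  show ?thesis
    unfolding f_def[symmetric]
    by (rule summary_triangle; use distinct_halves distinct_halves_rev f in \<open>(simp add: pull_apply swap3_apply)?\<close>)
      (simp add: f_def fpf_R choices)
qed

lemma summary_sts: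
  "summary (halves G) (join G) R (su \<circ> (tv \<circ> sw)) = summary (halves G - E) (join G) (R - E) (swap3 A1 A2 B1 B2 C1 C2)"
proof -
  define f where "f = su \<circ> (tv \<circ> sw)"
  have f: "f a1 = a2" "f a2 = a1" "f A1 = A2" "f A2 = A1" "f b1 = B2" "f B2 = b1" "f b2 = B1" "f B1 = b2" "f c1 = c2" "f c2 = c1" "f C1 = C2" "f C2 = C1"
    using distinct_halves distinct_halves_rev unfolding f_def by (simp_all add: swap2_apply)
  show ?thesis
    unfolding f_def[symmetric]
    by (rule summary_triangle; use distinct_halves distinct_halves_rev f in \<open>(simp add: pull_apply swap3_apply)?\<close>)
      (simp add: f_def fpf_R choices)
qed

lemma summary_sst:
  "summary (halves G) (join G) R (su \<circ> (sv \<circ> tw)) = summary (halves G - E) (join G) (R - E) (swap3 A1 A2 B1 B2 C1 C2)"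
proof -
  define f where "f = su \<circ> (sv \<circ> tw)"
  have f: "f a1 = a2" "f a2 = a1" "f A1 = A2" "f A2 = A1" "f b1 = b2" "f b2 = b1" "f B1 = B2" "f B2 = B1" "f c1 = C2" "f C2 = c1" "f c2 = C1" "f C1 = c2"
    using distinct_halves distinct_halves_rev unfolding f_def by (simp_all add: swap2_apply)
  show ?thesis
    unfolding f_def[symmetric]
    by (rule summary_triangle; use distinct_halves distinct_halves_rev f in \<open>(simp add: pull_apply swap3_apply)?\<close>)
      (simp add: f_def fpf_R choices)
qed

text \<open>With two letters \<open>t\<close>, the triangle is cut into two paths, both connecting
  these two vertices; the third vertex pairs its outer half-edges.\<close>

lemma summary_tts:
  "summary (halves G) (join G) R (tu \<circ> (tv \<circ> sw)) = summary (halves G - E) (join G) (R - E) (swap3 A2 B2 A1 B1 C1 C2)"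
proof -
  define f where "f = tu \<circ> (tv \<circ> sw)"
  have f: "f a1 = A2" "f A2 = a1" "f a2 = A1" "f A1 = a2" "f b1 = B2" "f B2 = b1" "f b2 = B1" "f B1 = b2" "f c1 = c2" "f c2 = c1" "f C1 = C2" "f C2 = C1"
    using distinct_halves distinct_halves_rev unfolding f_def by (simp_all add: swap2_apply)
  show ?thesis
    unfolding f_def[symmetric]
    by (rule summary_triangle; use distinct_halves distinct_halves_rev f in \<open>(simp add: pull_apply swap3_apply)?\<close>)
      (simp add: f_def fpf_R choices)
qed

lemma summary_tst:
  "summary (halves G) (join G) R (tu \<circ> (sv \<circ> tw)) = summary (halves G - E) (join G) (R - E) (swap3 A2 C2 A1 C1 B1 B2)"
proof -
  define f where "f = tu \<circ> (sv \<circ> tw)"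
  have f: "f a1 = A2" "f A2 = a1" "f a2 = A1" "f A1 = a2" "f b1 = b2" "f b2 = b1" "f B1 = B2" "f B2 = B1" "f c1 = C2" "f C2 = c1" "f c2 = C1" "f C1 = c2"
    using distinct_halves distinct_halves_rev unfolding f_def by (simp_all add: swap2_apply)
  show ?thesis
    unfolding f_def[symmetric]
    by (rule summary_triangle; use distinct_halves distinct_halves_rev f in \<open>(simp add: pull_apply swap3_apply)?\<close>)
      (simp add: f_def fpf_R choices)
qed

lemma summary_stt:
  "summary (halves G) (join G) R (su \<circ> (tv \<circ> tw)) = summary (halves G - E) (join G) (R - E) (swap3 A1 A2 B2 C1 B1 C2)"
proof -
  define f where "f = su \<circ> (tv \<circ> tw)"
  have f: "f a1 = a2" "f a2 = a1" "f A1 = A2" "f A2 = A1" "f b1 = B2" "f B2 = b1" "f b2 = B1" "f B1 = b2" "f c1 = C2" "f C2 = c1" "f c2 = C1" "f C1 = c2"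
    using distinct_halves distinct_halves_rev unfolding f_def by (simp_all add: swap2_apply)
  show ?thesis
    unfolding f_def[symmetric]
    by (rule summary_triangle; use distinct_halves distinct_halves_rev f in \<open>(simp add: pull_apply swap3_apply)?\<close>)
      (simp add: f_def fpf_R choices)
qed

text \<open>Each triangle edge becomes a separate path connecting the outer half-edges of its two
  vertices.\<close>

lemma summary_ttt:
  "summary (halves G) (join G) R (tu \<circ> (tv \<circ> tw)) = summary (halves G - E) (join G) (R - E) (swap3 A2 B2 A1 C1 B1 C2)"
proof -
  define f where "f = tu \<circ> (tv \<circ> tw)"
  have f: "f a1 = A2" "f A2 = a1" "f a2 = A1" "f A1 = a2" "f b1 = B2" "f B2 = b1" "f b2 = B1" "f B1 = b2" "f c1 = C2" "f C2 = c1" "f c2 = C1" "f C1 = c2"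
    using distinct_halves distinct_halves_rev unfolding f_def by (simp_all add: swap2_apply)
  show ?thesis
    unfolding f_def[symmetric]
    by (rule summary_triangle; use distinct_halves distinct_halves_rev f in \<open>(simp add: pull_apply swap3_apply)?\<close>)
      (simp add: f_def fpf_R choices)
qed

text \<open>Cutting off the corner at \<open>u\<close> and then removing the bigon formed by
  \<open>v\<close> and \<open>w\<close>, written as a single gluing of the whole star
  \<open>R\<close>; see \<open>knot_term_su\<close>.\<close>

definition \<rho> :: "nat \<Rightarrow> nat" where
  "\<rho> h = (if h \<in> {a1, a2, A1, A2} then su h else opp G h)"

lemma fpf_\<rho>: "fpf_involution R \<rho>"
proof -
  have f: "\<rho> a1 = a2" "\<rho> a2 = a1" "\<rho> A1 = A2" "\<rho> A2 = A1" "\<rho> b1 = B1" "\<rho> b2 = B2" "\<rho> B1 = b1"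
    "\<rho> B2 = b2" "\<rho> c1 = C1" "\<rho> c2 = C2" "\<rho> C1 = c1" "\<rho> C2 = c2"
    using distinct_halves distinct_halves_rev unfolding \<rho>_def by (simp_all add: swap2_apply)
  show ?thesis unfolding R fpf_involution_def using distinct_halves distinct_halves_rev f by simp
qed

lemma summary_\<rho>:
  "summary (halves G) (join G) R \<rho> = summary (halves G - E) (join G) (R - E) (swap3 A1 A2 B1 C2 B2 C1)"
proof -
  have f: "\<rho> a1 = a2" "\<rho> a2 = a1" "\<rho> A1 = A2" "\<rho> A2 = A1" "\<rho> b1 = B1" "\<rho> b2 = B2" "\<rho> B1 = b1"
    "\<rho> B2 = b2" "\<rho> c1 = C1" "\<rho> c2 = C2" "\<rho> C1 = c1" "\<rho> C2 = c2"
    using distinct_halves distinct_halves_rev unfolding \<rho>_def by (simp_all add: swap2_apply)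
  show ?thesis
    by (rule summary_triangle[OF fpf_\<rho>]; use distinct_halves distinct_halves_rev f in \<open>simp add: pull_apply swap3_apply\<close>)
qed

text \<open>With all three corners cut off, the triangle itself becomes a circle, and
  \<open>A1\<close> lies off it.\<close>

lemma knot_term_sss: "knot_term (splice G R (su \<circ> (sv \<circ> sw))) = 0"
proof (rule knot_term_splice_loop[OF framed, where E = E and x = a1 and y = A1])
  show "fpf_involution R (su \<circ> (sv \<circ> sw))" by (rule fpf_R) (rule choices)+
  show "E \<subseteq> R" unfolding R by blast
  show "A1 \<notin> E" using distinct_halves by auto
  show "join G h \<in> E" if "h \<in> E" for h using that by auto
  have "(su \<circ> (sv \<circ> sw)) a1 = a2" "(su \<circ> (sv \<circ> sw)) a2 = a1" "(su \<circ> (sv \<circ> sw)) b1 = b2"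
    "(su \<circ> (sv \<circ> sw)) b2 = b1" "(su \<circ> (sv \<circ> sw)) c1 = c2" "(su \<circ> (sv \<circ> sw)) c2 = c1"
    using distinct_halves distinct_halves_rev by (simp_all add: swap2_apply)
  then show "(su \<circ> (sv \<circ> sw)) h \<in> E" if "h \<in> E" for h using that by blast
qed simp_all

end

text \<open>Relabelling by \<open>\<pi>\<close> turns this graph into \<open>G\<close> with
  \<open>join\<close> conjugated instead. It is applied to the involution of the third move.\<close>

lemma framed_relabel:
  assumes "framed_4_graph G"
    and pi: "\<And>h. h \<in> halves G \<Longrightarrow> \<pi> h \<in> halves G" "\<And>h. \<pi> (\<pi> h) = h"
  defines "G' \<equiv> G\<lparr>vert := vert G \<circ> \<pi>, opp := \<pi> \<circ> opp G \<circ> \<pi>\<rparr>"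
  shows "framed_4_graph G'" "verts G' = verts G" "halves_at G' W = \<pi> ` halves_at G W"
proof -
  note F = framed_4_graphD[OF assms(1)]
  have inj: "inj \<pi>" using pi(2) by (metis injI)
  have im: "\<pi> ` halves G = halves G" using pi by (auto simp: image_iff) metis
  have at: "halves_at G' V = \<pi> ` halves_at G V" for V
  proof
    show "halves_at G' V \<subseteq> \<pi> ` halves_at G V"
    proof
      fix h assume "h \<in> halves_at G' V"
      then have "\<pi> h \<in> halves_at G V" using pi(1) by (simp add: G'_def)
      then have "\<pi> (\<pi> h) \<in> \<pi> ` halves_at G V" by (rule imageI)
      then show "h \<in> \<pi> ` halves_at G V" by (simp add: pi(2))
    qed
    show "\<pi> ` halves_at G V \<subseteq> halves_at G' V" using pi by (auto simp: G'_def)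
  qed
  then show "halves_at G' W = \<pi> ` halves_at G W" .
  show v: "verts G' = verts G"
    using arg_cong[OF im, of "(`) (vert G)"] by (simp add: verts_def G'_def image_image)
  have "card (halves_at G' {x}) = 4" if "x \<in> verts G'" for x
    using that assms(1) unfolding at v
    by (simp add: card_image inj_on_subset[OF inj] framed_4_graph_def)
  moreover have "\<pi> x \<noteq> \<pi> y" if "x \<noteq> y" for x y using that inj by (simp add: inj_eq)
  ultimately show "framed_4_graph G'"
    using F pi unfolding framed_4_graph_def by (auto simp: G'_def; metis)
qed

section \<open>The graph after the third move, on the same half-edges and edges\<close>

context triangle
begin

definition flip :: "nat \<Rightarrow> nat" where
  "flip = transpose A1 B1 \<circ> transpose B2 C1 \<circ> transpose C2 A2"

text \<open>The outcome of the move transported along \<open>flip\<close>: the conjugation of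
  \<open>join\<close> is traded for one of \<open>vert\<close> and \<open>opp\<close>. Since
  \<open>join\<close> stays fixed, the same triangle edges can be contracted on both sides.\<close>

definition flipped :: framed_graph where
  "flipped = G\<lparr>vert := vert G \<circ> flip, opp := flip \<circ> opp G \<circ> flip\<rparr>"

lemma flipped_simps [simp]:
  "halves flipped = halves G" "vert flipped h = vert G (flip h)"
  "opp flipped h = flip (opp G (flip h))" "join flipped = join G" "circles flipped = circles G"
  by (simp_all add: flipped_def)

lemma flip_simps [simp]:
  "flip A1 = B1" "flip B1 = A1" "flip B2 = C1" "flip C1 = B2" "flip C2 = A2" "flip A2 = C2"
  "flip a1 = a1" "flip a2 = a2" "flip b1 = b1" "flip b2 = b2" "flip c1 = c1" "flip c2 = c2"
  using distinct_halves distinct_halves_rev by (simp_all add: flip_def transpose_def)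

lemma flip_id: "h \<notin> R \<Longrightarrow> flip h = h"
  unfolding R by (simp add: flip_def transpose_def)

lemma flip_flip [simp]: "flip (flip h) = h"
proof (cases "h \<in> R")
  case True
  then show ?thesis unfolding R by auto
qed (simp add: flip_id del: halves_at_iff)

lemma flip_in [simp]: "h \<in> halves G \<Longrightarrow> flip h \<in> halves G"
proof (cases "h \<in> R")
  case True
  then show ?thesis unfolding R by auto
qed (simp add: flip_id del: halves_at_iff)

lemma framed_flipped: "framed_4_graph flipped"
  unfolding flipped_def by (rule framed_relabel(1)[OF framed]) auto

lemma verts_flipped: "verts flipped = verts G"
  unfolding flipped_def by (rule framed_relabel(2)[OF framed]) auto

text \<open>The move exchanges the outer half-edges at the two ends of each strand, here
  \<open>A1\<close> with \<open>B1\<close>, \<open>B2\<close> with \<open>C1\<close> and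
  \<open>C2\<close> with \<open>A2\<close>. All pairings computed for \<open>G\<close> thus hold
  after the move with the capitals exchanged.\<close>

lemma triangle_flipped: "triangle flipped u v w a1 a2 b1 b2 c1 c2 B1 C2 A1 C1 B2 A2"
proof
  show "framed_4_graph flipped" by (rule framed_flipped)
  show "distinct [u, v, w]" by (rule uvw)
qed (use distinct_halves distinct_halves_rev in auto)

lemma star_flipped: "halves_at flipped {u, v, w} = R"
  using triangle.R[OF triangle_flipped] R by auto

lemma outside:
  assumes "h \<in> halves G - R"
  shows "vert G h = vert flipped h \<and> opp G h = opp flipped h"
proof -
  have "opp G h \<notin> R" using assms framed_4_graphD(7)[OF framed] by auto
  then show ?thesis using assms by (simp add: flip_id del: halves_at_iff)
qed

lemma knot_term_flipped:
  assumes "fpf_involution R f" "fpf_involution R f'"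
    "summary (halves G) (join G) R f = summary (halves G) (join G) R f'"
  shows "knot_term (splice G R f) = knot_term (splice flipped R f')"
  using knot_term_splice_cong[OF framed framed_flipped _ _ _ star_flipped assms(1,2) outside assms(3)]
  by (simp add: star_flipped)

lemma bracket_all_even: "bracket flipped {u, v, w} = bracket G {u, v, w}"
proof -
  interpret F: triangle flipped u v w a1 a2 b1 b2 c1 c2 B1 C2 A1 C1 B2 A2
    by (rule triangle_flipped)
  let ?S = "summary (halves G - E) (join G) (R - E)"
  have X: "h \<in> {A1, A2, B1, B2, C1, C2}" if "h \<in> R - E" for h using that R by auto
  \<comment> \<open>The pairing of the three smoothings with one \<open>t\<close> is that of
    \<open>ttt\<close> on the other side, in both directions (first and last line); the three with
    two letters \<open>t\<close> keep their pairings.\<close>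
  have S: "?S (swap3 A1 A2 B1 B2 C1 C2) = ?S (swap3 C2 C1 B1 B2 A1 A2)"
    "?S (swap3 A2 B2 A1 B1 C1 C2) = ?S (swap3 C2 C1 B1 A1 B2 A2)"
    "?S (swap3 A2 C2 A1 C1 B1 B2) = ?S (swap3 C2 A2 B1 B2 A1 C1)"
    "?S (swap3 A1 A2 B2 C1 B1 C2) = ?S (swap3 B1 C2 C1 B2 A1 A2)"
    "?S (swap3 A2 B2 A1 C1 B1 C2) = ?S (swap3 B1 C2 A1 C1 B2 A2)"
    by (rule summary_cong, drule X, use distinct_halves distinct_halves_rev in \<open>auto simp: swap3_apply\<close>)+
  note fpf = fpf_R[OF choices(1,3,5)] fpf_R[OF choices(1,3,6)] fpf_R[OF choices(1,4,5)] fpf_R[OF choices(1,4,6)]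
    fpf_R[OF choices(2,3,5)] fpf_R[OF choices(2,3,6)] fpf_R[OF choices(2,4,5)] fpf_R[OF choices(2,4,6)]
  note fpf' = F.fpf_R[OF F.choices(1,3,5)] F.fpf_R[OF F.choices(1,3,6)] F.fpf_R[OF F.choices(1,4,5)]
    F.fpf_R[OF F.choices(1,4,6)] F.fpf_R[OF F.choices(2,3,5)] F.fpf_R[OF F.choices(2,3,6)]
    F.fpf_R[OF F.choices(2,4,5)] F.fpf_R[OF F.choices(2,4,6)]
  note fpf' = fpf'[unfolded star_flipped]
  note sum = summary_tss summary_sts summary_sst summary_tts summary_tst summary_stt summary_ttt
  note sum' = F.summary_tss F.summary_sts F.summary_sst F.summary_tts F.summary_tst F.summary_stt F.summary_ttt
  note sum' = sum'[unfolded star_flipped flipped_simps]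
  note eqs = knot_term_flipped[OF fpf(5) fpf'(8) trans[OF sum(1) trans[OF S(1) sum'(7)[symmetric]]]]
    knot_term_flipped[OF fpf(3) fpf'(8) trans[OF sum(2) trans[OF S(1) sum'(7)[symmetric]]]]
    knot_term_flipped[OF fpf(2) fpf'(8) trans[OF sum(3) trans[OF S(1) sum'(7)[symmetric]]]]
    knot_term_flipped[OF fpf(7) fpf'(7) trans[OF sum(4) trans[OF S(2) sum'(4)[symmetric]]]]
    knot_term_flipped[OF fpf(6) fpf'(6) trans[OF sum(5) trans[OF S(3) sum'(5)[symmetric]]]]
    knot_term_flipped[OF fpf(4) fpf'(4) trans[OF sum(6) trans[OF S(4) sum'(6)[symmetric]]]]
  note eqs' = knot_term_flipped[OF fpf(8) fpf'(5) trans[OF sum(7) trans[OF S(5) sum'(1)[symmetric]]], symmetric]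
    knot_term_flipped[OF fpf(8) fpf'(3) trans[OF sum(7) trans[OF S(5) sum'(2)[symmetric]]], symmetric]
    knot_term_flipped[OF fpf(8) fpf'(2) trans[OF sum(7) trans[OF S(5) sum'(3)[symmetric]]], symmetric]
  have 0: "knot_term (splice G R (su \<circ> (sv \<circ> sw))) = 0"
    "knot_term (splice flipped R (F.su \<circ> (F.sv \<circ> F.sw))) = 0"
    using knot_term_sss F.knot_term_sss unfolding star_flipped by simp_all
  show ?thesis
    \<comment> \<open>After rewriting, \<open>ttt\<close> of one side occurs three times in the sum
      of the other side and once in its own, and the remaining terms agree; modulo 2 the sums
      coincide.\<close>
    unfolding bracket_eq F.bracket_eq unfolding star_flipped
    unfolding eqs eqs' 0 by (simp add: ac_simps)
qed

text \<open>Cutting the corner at \<open>u\<close> fuses two triangle edges into the edge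
  \<open>b1 c2\<close>; together with \<open>b2 c1\<close> it bounds a bigon at \<open>v\<close> and
  \<open>w\<close>, removable by a second move.\<close>

lemma knot_term_su: "knot_term (smooth G {u} su) = knot_term (splice G R \<rho>)"
proof -
  let ?K = "splice G (halves_at G {u}) su"
  let ?Y = "splice ?K (halves_at ?K {v, w}) (opp ?K)"
  have fpf: "fpf_involution (halves_at G {u}) su" by (rule smoothing_choice_fpf[OF choices(1)])
  interpret g: gluing "halves G" "join G" "halves_at G {u}" su by (rule framed_gluing[OF framed fpf])
  have K: "framed_4_graph ?K" by (rule framed_splice[OF framed fpf])
  have s: "su a1 = a2" using distinct_halves distinct_halves_rev by (simp add: swap2_apply)
  have ne: "u \<noteq> v" "u \<noteq> w" "v \<noteq> w" "v \<noteq> u" "w \<noteq> u" "c2 \<noteq> b1" "c1 \<noteq> b2" using uvw distinct_halves by auto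
  have j1: "join ?K b1 = c2"
    unfolding splice_simps
  proof (rule g.other_end_unique)
    have "(b1, a1) \<in> paths (halves G) (join G) (halves_at G {u}) su"
      using paths_join[of b1 "halves G" "join G"] by simp
    moreover have "(a1, a2) \<in> paths (halves G) (join G) (halves_at G {u}) su"
      using paths_glue[of a1 "halves_at G {u}" su] s by simp
    moreover have "(a2, c2) \<in> paths (halves G) (join G) (halves_at G {u}) su"
      using paths_join[of a2 "halves G" "join G"] by simp
    ultimately show "(b1, c2) \<in> paths (halves G) (join G) (halves_at G {u}) su"
      by (blast intro: paths_trans)
  qed (use ne in auto)
  have j2: "join ?K b2 = c1"
    unfolding splice_simps
  proof (rule g.other_end_unique)
    show "(b2, c1) \<in> paths (halves G) (join G) (halves_at G {u}) su"
      using paths_join[of b2 "halves G" "join G"] by simp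
  qed (use ne in auto)
  have ne': "b1 \<noteq> b2" "b2 \<noteq> B1" "c1 \<noteq> C2" using distinct_halves by auto
  have "R2_removal ?K v w ?Y"
    unfolding R2_removal_def
    by (intro conjI, simp add: ne, rule bexI[of _ b1], rule bexI[of _ b2])
       (simp_all add: j1 j2 ne ne' del: splice_simps(4))
  then have 1: "knot_term ?K = knot_term ?Y" by (rule knot_term_R2[OF K])
  have at: "halves_at ?K {v, w} = halves_at G {v, w}" using ne by auto
  \<comment> \<open>Smoothing at \<open>u\<close> and removing the bigon are two stages of the
    single gluing \<open>\<rho>\<close>.\<close>
  have U: "{u} \<union> {v, w} = {u, v, w}" "{u} \<inter> {v, w} = {}" using ne by auto
  have in_u: "h \<in> {a1, a2, A1, A2} \<longleftrightarrow> h \<in> halves_at G {u}" for h unfolding stars ..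
  have "\<rho> h = su h" if "h \<in> halves_at G {u}" for h
    using that unfolding \<rho>_def in_u by simp
  moreover have "\<rho> h = opp G h" if "h \<in> halves_at G {v, w}" for h
    using that ne unfolding \<rho>_def in_u by auto
  ultimately have "framed_iso (splice G R \<rho>) (splice ?K (halves_at G {v, w}) (opp G)) id id"
    using framed_iso_splice_splice(1)[OF framed U(2) fpf framed_4_graphD(3)[OF framed], of \<rho>] U(1) by auto
  then have 2: "knot_term (splice G R \<rho>) = knot_term ?Y"
    using knot_term_iso[OF framed_splice[OF framed fpf_\<rho>] framed_splice[OF K framed_4_graphD(3)[OF K, of "{v, w}"]], of id id]
    by (simp add: at)
  show ?thesis using 1 2 by (simp add: smooth_def)
qed

text \<open>
  When \<open>u\<close> is smoothed the other way, the third move turns into an isomorphism interchanging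
  \<open>v\<close> and \<open>w\<close>. Removing the star of \<open>u\<close> deletes \<open>A1\<close>, \<open>A2\<close> from \<open>G\<close> but \<open>B1\<close>, \<open>C2\<close> from the
  flipped graph, so these four half-edges have to be traded for those of the triangle.
\<close>

definition exchange :: "nat \<Rightarrow> nat" where
  "exchange = id(b1 := A2, B1 := c2, b2 := c1, c1 := b2, C2 := b1, c2 := A1)"

text \<open>Every half-edge at \<open>u\<close> is connected to \<open>b1\<close> or
  \<open>c2\<close>, which belong to other vertices. So no circle arises on either side, and the
  circle counts agree in the isomorphism below.\<close>

lemma no_loops: "loops (halves G) (join G) (halves_at G {u}) tu = {}"
proof (rule ccontr)
  let ?P = "paths (halves G) (join G) (halves_at G {u}) tu"
  assume "loops (halves G) (join G) (halves_at G {u}) tu \<noteq> {}"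
  then obtain x where x: "x \<in> halves G" "?P `` {x} \<subseteq> halves_at G {u}"
    by (auto simp: loops_def quotient_def)
  have t: "tu A1 = a2" "tu A2 = a1" using distinct_halves distinct_halves_rev by (simp_all add: swap2_apply)
  have p: "(A1, a2) \<in> ?P" "(A2, a1) \<in> ?P" "(a1, b1) \<in> ?P" "(a2, c2) \<in> ?P"
    using paths_glue[of A1 "halves_at G {u}" tu] paths_glue[of A2 "halves_at G {u}" tu]
      paths_join[of a1 "halves G" "join G"] paths_join[of a2 "halves G" "join G"] t by auto
  have "x \<in> halves_at G {u}" using subsetD[OF x(2), of x] by simp
  then have "x \<in> {a1, a2, A1, A2}" unfolding stars .
  then have "(x, b1) \<in> ?P \<or> (x, c2) \<in> ?P" using p paths_trans[OF p(1,4)] paths_trans[OF p(2,3)] by blast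
  then have "b1 \<in> halves_at G {u} \<or> c2 \<in> halves_at G {u}" using x(2) by blast
  then show False using uvw by auto
qed

text \<open>After this smoothing, \<open>b1\<close> continues to where \<open>A2\<close> led and
  \<open>c2\<close> to where \<open>A1\<close> led; in the flipped graph \<open>b1\<close> and
  \<open>c2\<close> continue to where \<open>C2\<close> and \<open>B1\<close> led.
  \<open>exchange\<close> sends a half-edge at \<open>v\<close> or \<open>w\<close> to the one at
  the other vertex with the same continuation outside, and reverses the edge
  \<open>b2 c1\<close>.\<close>

lemma knot_term_tu:
  "knot_term (smooth G {u} tu) = knot_term (smooth flipped {u} (swap2 a1 C2 a2 B1))"
proof -
  interpret F: triangle flipped u v w a1 a2 b1 b2 c1 c2 B1 C2 A1 C1 B2 A2
    by (rule triangle_flipped)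
  let ?R = "halves_at G {u}" and ?R' = "halves_at flipped {u}" and ?t' = "swap2 a1 C2 a2 B1"
  let ?K = "splice G ?R tu" and ?K' = "splice flipped ?R' ?t'"
  let ?P' = "paths (halves G) (join G) ?R' ?t'"
  have fpf: "fpf_involution ?R tu" "fpf_involution ?R' ?t'"
    by (rule smoothing_choice_fpf[OF choices(2)], rule smoothing_choice_fpf[OF F.choices(2)])
  interpret g: gluing "halves G" "join G" ?R tu by (rule framed_gluing[OF framed fpf(1)])
  interpret g': gluing "halves G" "join G" ?R' ?t'
    using framed_gluing[OF framed_flipped fpf(2)] by simp
  have t: "tu a1 = A2" "tu A2 = a1" "tu a2 = A1" "tu A1 = a2"
    "?t' a1 = C2" "?t' C2 = a1" "?t' a2 = B1" "?t' B1 = a2"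
    using distinct_halves distinct_halves_rev by (simp_all add: swap2_apply)
  \<comment> \<open>\<open>p\<close> collapses the path \<open>A2, a1, b1\<close> to
    \<open>A2\<close> and \<open>A2\<close>'s counterpart \<open>A1, a2, c2\<close> to
    \<open>A1\<close>, and reverses \<open>b2 c1\<close>, so each step of the first gluing becomes a
    path of the second.\<close>
  define p where "p = id(b1 := A2, a1 := A2, c2 := A1, a2 := A1, b2 := c1, c1 := b2)"
  have pv: "p b1 = A2" "p a1 = A2" "p c2 = A1" "p a2 = A1" "p b2 = c1" "p c1 = b2" "p A1 = A1" "p A2 = A2"
    "p B1 = B1" "p C2 = C2"
    using distinct_halves distinct_halves_rev by (simp_all add: p_def)
  have pid: "p h = h" if "h \<notin> E" for h using that by (simp add: p_def)
  have ev: "exchange b1 = A2" "exchange B1 = c2" "exchange b2 = c1" "exchange c1 = b2" "exchange C2 = b1"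
    "exchange c2 = A1" "exchange B2 = B2" "exchange C1 = C1" "exchange A1 = A1"
    using distinct_halves distinct_halves_rev by (simp_all add: exchange_def)
  have eid: "exchange h = h" if "h \<notin> {b1, B1, b2, c1, C2, c2}" for h using that by (simp add: exchange_def)
  have map: "(p x, p y) \<in> ?P'" if "(x, y) \<in> paths (halves G) (join G) ?R tu" for x y
    using that
  proof (rule paths_map)
    fix h assume h: "h \<in> halves G"
    show "(p h, p (join G h)) \<in> ?P'"
    proof (cases "h \<in> E")
      case True
      have bc: "(c1, b2) \<in> ?P'" "(b2, c1) \<in> ?P'"
        using paths_join[of c1 "halves G" "join G"] paths_join[of b2 "halves G" "join G"] by auto
      show ?thesis using True by (auto simp: pv bc)
    next
      case False
      then have "join G h \<notin> E" using h framed_4_graphD(10)[OF framed h] join_simps by (metis insertE insertI1 insertI2 empty_iff)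
      then show ?thesis using False h paths_join[of h "halves G" "join G"] by (simp add: pid)
    qed
  next
    fix h assume "h \<in> ?R"
    then have "h \<in> {a1, a2, A1, A2}" unfolding stars .
    then show "(p h, p (tu h)) \<in> ?P'" by (auto simp: t pv)
  qed
  have steps: "(a1, C2) \<in> ?P'" "(a2, B1) \<in> ?P'" "(b1, a1) \<in> ?P'" "(c2, a2) \<in> ?P'"
    using paths_glue[of a1 ?R' ?t'] paths_glue[of a2 ?R' ?t'] t
      paths_join[of b1 "halves G" "join G"] paths_join[of c2 "halves G" "join G"] F.stars(1) by auto
  \<comment> \<open>On survivors, \<open>exchange\<close> and \<open>p\<close> differ only at
    \<open>B1\<close> and \<open>C2\<close>, which are deleted on the other side;
    \<open>exchange\<close> replaces them by \<open>c2\<close> and \<open>b1\<close>, the far ends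
    of their paths through the star of \<open>u\<close>.\<close>
  have near: "(exchange h, p h) \<in> ?P'" if "h \<in> halves G - ?R" for h
  proof -
    have "h \<notin> {a1, a2, A1, A2}" using that unfolding stars by blast
    moreover have "(c2, B1) \<in> ?P'" "(b1, C2) \<in> ?P'" using steps paths_trans by metis+
    ultimately show ?thesis
      by (cases "h \<in> {b1, B1, b2, c1, C2, c2}") (auto simp: ev pv eid pid)
  qed
  have outR: "h \<in> halves G - ?R \<longleftrightarrow> h \<in> halves G \<and> h \<notin> {a1, a2, A1, A2}" for h unfolding stars by blast
  have outR': "h \<in> halves G - ?R' \<longleftrightarrow> h \<in> halves G \<and> h \<notin> {a1, a2, B1, C2}" for h unfolding F.stars by blast
  have e_in: "exchange h \<in> halves G - ?R'" if "h \<in> halves G - ?R" for h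
    using that unfolding outR outR'
    by (cases "h \<in> {b1, B1, b2, c1, C2, c2}") (use distinct_halves distinct_halves_rev eid[of h] in \<open>auto simp: ev\<close>)
  have e_inj: "inj_on exchange (halves G - ?R)"
  proof (rule inj_on_inverseI)
    \<comment> \<open>The inverse assignment on the images of the half-edges that
      \<open>exchange\<close> moves.\<close>
    define e' where "e' = id(A2 := b1, c2 := B1, c1 := b2, b2 := c1, b1 := C2, A1 := c2)"
    have e': "e' A2 = b1" "e' c2 = B1" "e' c1 = b2" "e' b2 = c1" "e' b1 = C2" "e' A1 = c2"
      using distinct_halves distinct_halves_rev by (simp_all add: e'_def)
    fix h assume "h \<in> halves G - ?R"
    then have h: "h \<notin> {a1, a2, A1, A2}" unfolding outR by simp
    show "e' (exchange h) = h"
    proof (cases "h \<in> {b1, B1, b2, c1, C2, c2}")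
      case True
      then show ?thesis by (auto simp: ev e')
    next
      case False
      then show ?thesis using eid[OF False] h by (simp add: e'_def)
    qed
  qed
  have e_surj: "exchange ` (halves G - ?R) = halves G - ?R'"
  proof
    show "exchange ` (halves G - ?R) \<subseteq> halves G - ?R'" using e_in by blast
    have "card ?R = card ?R'" unfolding stars F.stars using distinct_halves F.distinct_halves by simp
    then have "card (halves G - ?R) = card (halves G - ?R')"
      using g.finite_H g.R_sub g'.R_sub by (simp add: card_Diff_subset finite_subset del: halves_at_iff)
    then show "halves G - ?R' \<subseteq> exchange ` (halves G - ?R)"
      using card_image[OF e_inj] e_in g.finite_H
      by (metis card_subset_eq finite_Diff image_subsetI order_refl)
  qed
  have e_join: "other_end (halves G) (join G) ?R' ?t' (exchange h)
      = exchange (other_end (halves G) (join G) ?R tu h)" if h: "h \<in> halves G - ?R" for h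
  proof (rule g'.other_end_unique)
    let ?k = "other_end (halves G) (join G) ?R tu h"
    note k = g.other_end[OF h]
    show "exchange h \<in> halves G - ?R'" "exchange ?k \<in> halves G - ?R'" using e_in h k(1) by blast+
    show "exchange ?k \<noteq> exchange h" using e_inj h k by (metis inj_onD)
    show "(exchange h, exchange ?k) \<in> ?P'"
      using near[OF h] map[OF k(3)] near[OF k(1)] g'.paths_sym paths_trans by metis
  qed
  define g where "g = transpose v w"
  have gv: "g v = w" "g w = v" "x \<noteq> v \<Longrightarrow> x \<noteq> w \<Longrightarrow> g x = x" for x
    using uvw by (simp_all add: g_def transpose_def)
  have e_vo: "vert flipped (exchange h) = g (vert G h) \<and> opp flipped (exchange h) = exchange (opp G h)"
    if h: "h \<in> halves G - ?R" for h
  proof (cases "h \<in> R")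
    case True
    then have "h \<in> {b1, b2, B1, B2, c1, c2, C1, C2}" using h unfolding outR R by blast
    then show ?thesis by (auto simp: ev gv)
  next
    case False
    have "opp G h \<notin> R" "vert G h \<noteq> v" "vert G h \<noteq> w" "h \<in> halves G"
      using False h framed_4_graphD(7)[OF framed] by auto
    moreover have "exchange x = x" if "x \<notin> R" for x using that eid[of x] unfolding R by blast
    ultimately show ?thesis using False outside[of h] gv(3) by (simp del: halves_at_iff flipped_simps)
  qed
  have vw: "v \<in> verts G" "w \<in> verts G"
    unfolding verts_def using in_halves(3,5) vert_simps(5,9) by (metis imageI)+
  have "bij_betw g (verts G - {u}) (verts G - {u})"
    by (rule bij_betw_byWitness[where f' = g]) (use vw uvw gv in \<open>auto simp: g_def transpose_def\<close>)
  then have "framed_iso ?K ?K' exchange g"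
    unfolding framed_iso_def verts_splice verts_flipped
    using e_inj e_surj e_join e_vo no_loops F.no_loops
    by (auto simp: bij_betw_def simp del: halves_at_iff flipped_simps(2,3))
  then show ?thesis
    unfolding smooth_def
    by (rule knot_term_iso[OF framed_splice[OF framed fpf(1)] framed_splice[OF framed_flipped fpf(2)]])
qed

lemma bracket_one_even: "bracket flipped {u} = bracket G {u}"
proof -
  interpret F: triangle flipped u v w a1 a2 b1 b2 c1 c2 B1 C2 A1 C1 B2 A2
    by (rule triangle_flipped)
  let ?S = "summary (halves G - E) (join G) (R - E)"
  have X: "h \<in> {A1, A2, B1, B2, C1, C2}" if "h \<in> R - E" for h using that R by auto
  \<comment> \<open>Removing the bigon leaves the pairs \<open>A1 A2\<close>, \<open>B1 C2\<close>,
    \<open>B2 C1\<close> on both sides; exchanging the ends of the strands permutes these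
    pairs.\<close>
  have "?S (swap3 A1 A2 B1 C2 B2 C1) = ?S (swap3 B1 C2 A1 A2 C1 B2)"
    by (rule summary_cong, drule X, use distinct_halves distinct_halves_rev in \<open>auto simp: swap3_apply\<close>)
  then have "summary (halves G) (join G) R \<rho> = summary (halves G) (join G) R F.\<rho>"
    using summary_\<rho> F.summary_\<rho> unfolding star_flipped by simp
  then have "knot_term (splice G R \<rho>) = knot_term (splice flipped R F.\<rho>)"
    using fpf_\<rho> F.fpf_\<rho> unfolding star_flipped by (intro knot_term_flipped)
  then show ?thesis
    unfolding bracket_def sum_choices F.sum_choices knot_term_su F.knot_term_su knot_term_tu star_flipped
    by simp
qed

text \<open>The edges \<open>a1 b1\<close>, \<open>b2 c1\<close>, \<open>c2 a2\<close> are read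
  cyclically from the second one on, which forces the swapped indices. This reduces a single even
  vertex \<open>v\<close> or \<open>w\<close> to the case of \<open>u\<close>.\<close>

lemma rotated: "triangle G v w u b2 b1 c1 c2 a2 a1 B2 B1 C1 C2 A2 A1"
proof
  show "framed_4_graph G" by (rule framed)
  show "distinct [v, w, u]" using uvw by auto
qed (use distinct_halves distinct_halves_rev in auto)

text \<open>Rotation only permutes the three disjoint transpositions composing
  \<open>flip\<close>.\<close>

lemma flipped_rotated: "triangle.flipped G B2 B1 C1 C2 A2 A1 = flipped"
proof -
  have "triangle.flip B2 B1 C1 C2 A2 A1 = flip"
    unfolding triangle.flip_def[OF rotated] flip_def
    using distinct_halves distinct_halves_rev by (auto simp: fun_eq_iff transpose_def)
  then show ?thesis unfolding triangle.flipped_def[OF rotated] flipped_def by simp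
qed

end

lemma smoothing_choice_cong:
  assumes "smoothing_choice G W \<sigma>" "halves_at G' W = halves_at G W"
    and "\<And>h. h \<in> halves_at G W \<Longrightarrow> vert G' h = vert G h" "\<And>h. h \<in> halves_at G W \<Longrightarrow> opp G' h = opp G h"
  shows "smoothing_choice G' W \<sigma>"
proof (rule smoothing_choiceI)
  fix h assume "h \<in> halves_at G' W"
  then have h: "h \<in> halves_at G W" using assms(2) by simp
  have s: "\<sigma> h \<in> halves_at G W \<and> vert G (\<sigma> h) = vert G h \<and> \<sigma> h \<noteq> h \<and> \<sigma> h \<noteq> opp G h \<and> \<sigma> (\<sigma> h) = h"
    using smoothing_choiceD(1)[OF assms(1)] h by simp
  then show "\<sigma> h \<in> halves_at G' W \<and> vert G' (\<sigma> h) = vert G' h \<and> \<sigma> h \<noteq> h \<and> \<sigma> h \<noteq> opp G' h \<and> \<sigma> (\<sigma> h) = h"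
    using assms(3,4)[OF h] assms(3)[of "\<sigma> h"] assms(2) by (simp del: halves_at_iff)
qed (use smoothing_choiceD(2)[OF assms(1)] assms(2) in metis)

section \<open>Strands through the triangle and the component number\<close>

context triangle
begin

lemma summary_opp:
  "summary (halves G) (join G) R (opp G) = summary (halves G - E) (join G) (R - E) (swap3 A1 B1 B2 C1 C2 A2)"
  by (rule summary_triangle[OF framed_4_graphD(3)[OF framed]];
      use distinct_halves distinct_halves_rev in \<open>simp add: pull_apply swap3_apply\<close>)

text \<open>Passing straight through, each strand connects the same two outer half-edges before and
  after the move. Removing the star along \<open>opp\<close> keeps the component number and gives
  isomorphic results.\<close>

lemma num_unicursal_flipped: "num_unicursal flipped = num_unicursal G"
proof -
  interpret F: triangle flipped u v w a1 a2 b1 b2 c1 c2 B1 C2 A1 C1 B2 A2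
    by (rule triangle_flipped)
  let ?S = "summary (halves G - E) (join G) (R - E)"
  have X: "h \<in> {A1, A2, B1, B2, C1, C2}" if "h \<in> R - E" for h using that R by auto
  have "?S (swap3 A1 B1 B2 C1 C2 A2) = ?S (swap3 B1 A1 C1 B2 A2 C2)"
    by (rule summary_cong, drule X, use distinct_halves distinct_halves_rev in \<open>auto simp: swap3_apply\<close>)
  then have S: "summary (halves G) (join G) R (opp G) = summary (halves G) (join G) R (opp flipped)"
    using summary_opp F.summary_opp unfolding star_flipped by simp
  note fpf = framed_4_graphD(3)[OF framed, of "{u, v, w}"]
    framed_4_graphD(3)[OF framed_flipped, of "{u, v, w}", unfolded star_flipped]
  have "framed_iso (splice G R (opp G)) (splice flipped R (opp flipped)) id id"
    by (rule framed_iso_splice_id) (use S outside in \<open>auto simp: summary_def simp del: halves_at_iff\<close>)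
  moreover have "framed_4_graph (splice flipped R (opp flipped))"
    using framed_splice[OF framed_flipped, of "{u, v, w}"] fpf(2) unfolding star_flipped by blast
  ultimately have "num_unicursal (splice flipped R (opp flipped)) = num_unicursal (splice G R (opp G))"
    using num_unicursal_iso framed_splice[OF framed fpf(1)] by blast
  then show ?thesis
    using num_unicursal_splice_opp[OF framed, of "{u, v, w}"]
      num_unicursal_splice_opp[OF framed_flipped, of "{u, v, w}"] unfolding star_flipped by simp
qed

lemma bracket_flipped:
  assumes "V \<subseteq> {u, v, w}" "even (card ({u, v, w} - V))"
  shows "bracket flipped V = bracket G V"
proof -
  have "bracket flipped {v} = bracket G {v}"
    using triangle.bracket_one_even[OF rotated] by (simp add: flipped_rotated)
  moreover have "bracket flipped {w} = bracket G {w}"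
    using triangle.bracket_one_even[OF triangle.rotated[OF rotated]]
    by (simp add: triangle.flipped_rotated[OF rotated] flipped_rotated)
  \<comment> \<open>An even number of omitted vertices is none or two.\<close>
  moreover have "V = {u, v, w} \<or> V = {u} \<or> V = {v} \<or> V = {w}"
  proof -
    have V: "V = (if u \<in> V then {u} else {}) \<union> (if v \<in> V then {v} else {}) \<union> (if w \<in> V then {w} else {})"
      using assms(1) by auto
    have "{u, v, w} - V = (if u \<in> V then {} else {u}) \<union> (if v \<in> V then {} else {v}) \<union> (if w \<in> V then {} else {w})"
      by auto
    then have "card ({u, v, w} - V) = (if u \<in> V then 0 else 1) + (if v \<in> V then 0 else 1) + (if w \<in> V then 0 else 1)"
      using uvw by auto
    then show ?thesis using assms(2) V by (auto split: if_splits)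
  qed
  ultimately show ?thesis using bracket_all_even bracket_one_even by auto
qed

end

subsection \<open>Invariance of the bracket\<close>

text \<open>An edge with no half at a removed vertex survives. Hence the loop, bigon or triangle of
  a move is still present once the other even vertices are smoothed.\<close>

lemma join_splice:
  assumes "framed_4_graph G" "fpf_involution (halves_at G W) \<sigma>"
    and "h \<in> halves G - halves_at G W" "join G h \<notin> halves_at G W"
  shows "join (splice G (halves_at G W) \<sigma>) h = join G h"
proof -
  interpret gluing "halves G" "join G" "halves_at G W" \<sigma>
    by (rule framed_gluing) fact+
  show ?thesis
    unfolding splice_simps using assms(3,4) paths_join[of h "halves G" "join G"]
    by (intro other_end_unique) (auto simp del: halves_at_iff)
qed

text \<open>Both orders are two-stage versions of one splice at \<open>W \<union> V\<close>.\<close>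

lemma knot_term_splice_commute:
  assumes "framed_4_graph G" "W \<inter> V = {}"
    and "fpf_involution (halves_at G W) \<sigma>" "fpf_involution (halves_at G V) \<tau>"
  shows "knot_term (splice (splice G (halves_at G W) \<sigma>) (halves_at G V) \<tau>)
    = knot_term (splice (splice G (halves_at G V) \<tau>) (halves_at G W) \<sigma>)"
proof -
  define t where "t h = (if h \<in> halves_at G W then \<sigma> h else \<tau> h)" for h
  have VW: "V \<inter> W = {}" "V \<union> W = W \<union> V" using assms(2) by auto
  have t: "h \<in> halves_at G W \<Longrightarrow> t h = \<sigma> h" "h \<in> halves_at G V \<Longrightarrow> t h = \<tau> h" for h
    using assms(2) by (auto simp: t_def)
  note i = framed_iso_splice_splice[OF assms t] framed_iso_splice_splice(1)[OF assms(1) VW(1) assms(4,3) t(2,1)]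
  have at: "halves_at (splice G (halves_at G W) \<sigma>) V = halves_at G V"
    "halves_at (splice G (halves_at G V) \<tau>) W = halves_at G W"
    using assms(2) by auto
  note K = framed_splice[OF assms(1,3)] framed_splice[OF assms(1,4)]
  have "knot_term (splice G (halves_at G (W \<union> V)) t)
      = knot_term (splice (splice G (halves_at G W) \<sigma>) (halves_at G V) \<tau>)"
    by (rule knot_term_iso[OF framed_splice[OF assms(1) i(2)] _ i(1)])
      (use framed_splice[OF K(1), of V \<tau>] assms(4) in \<open>simp_all add: at del: halves_at_iff\<close>)
  moreover have "knot_term (splice G (halves_at G (W \<union> V)) t)
      = knot_term (splice (splice G (halves_at G V) \<tau>) (halves_at G W) \<sigma>)"
    by (rule knot_term_iso[OF framed_splice[OF assms(1) i(2)] _ i(3)[unfolded VW(2)]])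
      (use framed_splice[OF K(2), of W \<sigma>] assms(3) in \<open>simp_all add: at del: halves_at_iff\<close>)
  ultimately show ?thesis by simp
qed

text \<open>The common end of the first two moves: after smoothing \<open>W\<close>, the local
  identity has replaced the sum at \<open>V\<close> by the removal of \<open>V\<close>, and this
  removal commutes with the smoothing.\<close>

lemma bracket_removal:
  assumes "framed_4_graph G" "W \<inter> V = {}"
    and "\<And>\<sigma>. smoothing_choice G W \<sigma> \<Longrightarrow>
      F \<sigma> = knot_term (splice (smooth G W \<sigma>) (halves_at (smooth G W \<sigma>) V) (opp (smooth G W \<sigma>)))"
  shows "(\<Sum>\<sigma> | smoothing_choice G W \<sigma>. F \<sigma>) = bracket (splice G (halves_at G V) (opp G)) W"
proof -
  have VW: "V \<inter> W = {}" using assms(2) by auto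
  have at: "halves_at (splice G (halves_at G W) \<sigma>) V = halves_at G V"
    "halves_at (splice G (halves_at G V) (opp G)) W = halves_at G W" for \<sigma>
    using assms(2) by auto
  show ?thesis
    unfolding bracket_def smoothing_choice_splice[OF VW]
  proof (rule sum.cong[OF refl], simp only: mem_Collect_eq)
    fix \<sigma> assume s: "smoothing_choice G W \<sigma>"
    show "F \<sigma> = knot_term (smooth (splice G (halves_at G V) (opp G)) W \<sigma>)"
      unfolding assms(3)[OF s] smooth_def at
      using knot_term_splice_commute[OF assms(1,2) smoothing_choice_fpf[OF s] framed_4_graphD(3)[OF assms(1)]]
      by simp
  qed
qed

lemma bracket_R1_removal:
  assumes "framed_4_graph G" "R1_removal G v G'" "v \<notin> W"
  shows "bracket G (W \<union> {v}) = bracket G' W"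
proof -
  obtain a where a: "a \<in> halves G" "vert G a = v" "vert G (join G a) = v" "join G a \<noteq> opp G a"
    and G': "G' = splice G (halves_at G {v}) (opp G)"
    using assms(2) by (auto simp: R1_removal_def)
  have W: "W \<inter> {v} = {}" using assms(3) by simp
  show ?thesis
    unfolding G' bracket_Un[OF assms(1) W]
  proof (rule bracket_removal[OF assms(1) W])
    fix \<sigma> assume s: "smoothing_choice G W \<sigma>"
    have "join (smooth G W \<sigma>) a = join G a"
      unfolding smooth_def
      by (rule join_splice[OF assms(1) smoothing_choice_fpf[OF s]]) (use a assms(3) in auto)
    then show "bracket (smooth G W \<sigma>) {v} =
        knot_term (splice (smooth G W \<sigma>) (halves_at (smooth G W \<sigma>) {v}) (opp (smooth G W \<sigma>)))"
      using a assms(3)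
      by (intro bracket_R1[OF framed_smooth[OF assms(1) s]]) (auto simp: smooth_def)
  qed
qed

text \<open>The first equation is for even \<open>u\<close> and \<open>v\<close>. The second is for
  odd ones: the bigon persists in every smoothed graph and is removed there by an identity in the
  quotient.\<close>

lemma bracket_R2_removal:
  assumes "framed_4_graph G" "R2_removal G u v G'" "u \<notin> W" "v \<notin> W"
  shows "bracket G (W \<union> {u, v}) = bracket G' W" and "bracket G W = bracket G' W"
proof -
  obtain a b where a: "a \<in> halves G" "b \<in> halves G" "vert G a = u" "vert G b = u" "a \<noteq> b" "b \<noteq> opp G a"
      "vert G (join G a) = v" "vert G (join G b) = v" "join G b \<noteq> opp G (join G a)"
    and G': "G' = splice G (halves_at G {u, v}) (opp G)" and uv: "u \<noteq> v"
    using assms(2) by (auto simp: R2_removal_def)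
  have W: "W \<inter> {u, v} = {}" using assms(3,4) by simp
  have j: "join (smooth G W \<sigma>) a = join G a" "join (smooth G W \<sigma>) b = join G b"
    if "smoothing_choice G W \<sigma>" for \<sigma>
    unfolding smooth_def
    by (rule join_splice[OF assms(1) smoothing_choice_fpf[OF that]]; use a assms(3,4) in auto)+
  show "bracket G (W \<union> {u, v}) = bracket G' W"
    unfolding G' bracket_Un[OF assms(1) W]
  proof (rule bracket_removal[OF assms(1) W])
    fix \<sigma> assume s: "smoothing_choice G W \<sigma>"
    show "bracket (smooth G W \<sigma>) {u, v} =
        knot_term (splice (smooth G W \<sigma>) (halves_at (smooth G W \<sigma>) {u, v}) (opp (smooth G W \<sigma>)))"
      by (rule bracket_R2[OF framed_smooth[OF assms(1) s] uv, of a b])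
        (use a assms(3,4) j[OF s] in \<open>auto simp: smooth_def simp del: splice_simps(4)\<close>)
  qed
  show "bracket G W = bracket G' W"
    unfolding G' bracket_def[of G]
  proof (rule bracket_removal[OF assms(1) W])
    fix \<sigma> assume s: "smoothing_choice G W \<sigma>"
    let ?K = "smooth G W \<sigma>"
    have ab: "a \<in> halves ?K" "b \<in> halves ?K" using a assms(3) by (auto simp: smooth_def)
    have vo: "vert ?K = vert G" "opp ?K = opp G" by (simp_all add: smooth_def)
    have "\<exists>a\<in>halves ?K. \<exists>b\<in>halves ?K. vert ?K a = u \<and> vert ?K b = u \<and> a \<noteq> b \<and> b \<noteq> opp ?K a \<and>
        vert ?K (join ?K a) = v \<and> vert ?K (join ?K b) = v \<and> join ?K b \<noteq> opp ?K (join ?K a)"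
      by (rule bexI[OF bexI[OF _ ab(2)] ab(1)]) (simp add: j[OF s] vo a)
    then have "R2_removal ?K u v (splice ?K (halves_at ?K {u, v}) (opp ?K))"
      using uv by (simp add: R2_removal_def)
    then show "knot_term ?K = knot_term (splice ?K (halves_at ?K {u, v}) (opp ?K))"
      by (rule knot_term_R2[OF framed_smooth[OF assms(1) s]])
  qed
qed

lemma (in triangle) triangle_smooth:
  assumes "smoothing_choice G W \<sigma>" "W \<inter> {u, v, w} = {}"
  shows "triangle (smooth G W \<sigma>) u v w a1 a2 b1 b2 c1 c2 A1 A2 B1 B2 C1 C2"
proof
  show "framed_4_graph (smooth G W \<sigma>)" by (rule framed_smooth[OF framed assms(1)])
  have W: "u \<notin> W" "v \<notin> W" "w \<notin> W" using assms(2) by auto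
  note j = join_splice[OF framed smoothing_choice_fpf[OF assms(1)]]
  show "join (smooth G W \<sigma>) a1 = b1" "join (smooth G W \<sigma>) b2 = c1" "join (smooth G W \<sigma>) c2 = a2"
    unfolding smooth_def using j[of a1] j[of b2] j[of c2] W by simp_all
  show "distinct [u, v, w]" by (rule uvw)
  show "a1 \<in> halves_at (smooth G W \<sigma>) {u}" "a2 \<in> halves_at (smooth G W \<sigma>) {u}"
    "b1 \<in> halves_at (smooth G W \<sigma>) {v}" "b2 \<in> halves_at (smooth G W \<sigma>) {v}"
    "c1 \<in> halves_at (smooth G W \<sigma>) {w}" "c2 \<in> halves_at (smooth G W \<sigma>) {w}"
    using W by (simp_all add: smooth_def)
qed (use distinct_halves in \<open>auto simp: smooth_def\<close>)

lemma (in triangle) bracket_flipped_Un: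
  assumes "even (card ({u, v, w} - W))"
  shows "bracket flipped W = bracket G W"
proof -
  define W0 V where "W0 = W - {u, v, w}" and "V = W \<inter> {u, v, w}"
  have W: "W = W0 \<union> V" "W0 \<inter> V = {}" "W0 \<inter> {u, v, w} = {}" "V \<subseteq> {u, v, w}" "{u, v, w} - W = {u, v, w} - V"
    by (auto simp: W0_def V_def)
  have out: "h \<notin> R" if "h \<in> halves_at G W0" for h using that W(3) by auto
  have at: "halves_at flipped W0 = halves_at G W0"
  proof -
    have "vert flipped h \<in> W0 \<longleftrightarrow> vert G h \<in> W0" if "h \<in> halves G" for h
    proof (cases "h \<in> R")
      case True
      then have "vert flipped h \<in> {u, v, w}" "vert G h \<in> {u, v, w}"
        using star_flipped halves_at_iff[of h flipped "{u, v, w}"] by auto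
      then show ?thesis using W(3) by blast
    next
      case False
      then show ?thesis using outside[of h] that by simp
    qed
    then show ?thesis by auto
  qed
  have sc: "smoothing_choice flipped W0 = smoothing_choice G W0"
  proof -
    have vo: "vert flipped h = vert G h" "opp flipped h = opp G h" if "h \<in> halves_at G W0" for h
      using outside[of h] out[OF that] that by simp_all
    show ?thesis
    proof (intro ext iffI)
      fix \<sigma>
      show "smoothing_choice flipped W0 \<sigma>" if "smoothing_choice G W0 \<sigma>"
        using that at vo by (rule smoothing_choice_cong)
      show "smoothing_choice G W0 \<sigma>" if "smoothing_choice flipped W0 \<sigma>"
        using that by (rule smoothing_choice_cong) (simp_all only: at vo)
    qed
  qed
  \<comment> \<open>Flipping changes only \<open>vert\<close> and \<open>opp\<close>, smoothing only
    \<open>halves\<close>, \<open>join\<close> and \<open>circles\<close>, and the stars are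
    disjoint; so the two operations commute as an equality of records.\<close>
  have sm: "smooth flipped W0 \<sigma> = triangle.flipped (smooth G W0 \<sigma>) A1 A2 B1 B2 C1 C2"
    if "smoothing_choice G W0 \<sigma>" for \<sigma>
    unfolding triangle.flipped_def[OF triangle_smooth[OF that W(3)]]
    unfolding smooth_def splice_def at path_rel_def by (simp add: flipped_def)
  have "bracket flipped W = (\<Sum>\<sigma> | smoothing_choice G W0 \<sigma>. bracket (smooth flipped W0 \<sigma>) V)"
    unfolding W(1) bracket_Un[OF framed_flipped W(2)] sc ..
  also have "\<dots> = (\<Sum>\<sigma> | smoothing_choice G W0 \<sigma>. bracket (smooth G W0 \<sigma>) V)"
    by (rule sum.cong[OF refl])
      (use assms W(5) triangle.bracket_flipped[OF triangle_smooth[OF _ W(3)] W(4)] in \<open>simp add: sm\<close>)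
  also have "\<dots> = bracket G W"
    unfolding W(1) bracket_Un[OF framed W(2)] ..
  finally show ?thesis .
qed

text \<open>The involution of the move is \<open>flip\<close>, and \<open>flip\<close> itself is the
  isomorphism from \<open>flipped\<close> to the outcome, fixing all vertex labels.\<close>

lemma R3_move_flipped:
  assumes "framed_4_graph G" "R3_move G u v w G'"
  obtains a1 a2 b1 b2 c1 c2 A1 A2 B1 B2 C1 C2
  where "triangle G u v w a1 a2 b1 b2 c1 c2 A1 A2 B1 B2 C1 C2"
    and "\<exists>f. framed_iso (triangle.flipped G A1 A2 B1 B2 C1 C2) G' f id"
proof -
  obtain a1 a2 b1 b2 c1 c2 where t: "triangle G u v w a1 a2 b1 b2 c1 c2
      (opp G a1) (opp G a2) (opp G b1) (opp G b2) (opp G c1) (opp G c2)"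
    and G': "let \<tau> = transpose (opp G a1) (opp G b1) \<circ> transpose (opp G b2) (opp G c1) \<circ>
        transpose (opp G c2) (opp G a2) in G' = G\<lparr>join := \<tau> \<circ> join G \<circ> \<tau>\<rparr>"
    using assms unfolding R3_move_def triangle_def insert_subset by blast
  define A1 A2 B1 B2 C1 C2 where AC: "A1 = opp G a1" "A2 = opp G a2" "B1 = opp G b1" "B2 = opp G b2"
    "C1 = opp G c1" "C2 = opp G c2"
  note t = t[folded AC] and G' = G'[folded AC]
  interpret triangle G u v w a1 a2 b1 b2 c1 c2 A1 A2 B1 B2 C1 C2
    by (rule t)
  have G': "G' = G\<lparr>join := flip \<circ> join G \<circ> flip\<rparr>" using G' unfolding Let_def flip_def .
  have "bij_betw flip (halves G) (halves G)"
    by (rule bij_betw_byWitness[where f' = flip]) auto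
  moreover have "verts G' = verts G" by (simp add: G' verts_def)
  ultimately have "framed_iso flipped G' flip id"
    unfolding framed_iso_def verts_flipped by (simp add: G')
  then show thesis using that t by blast
qed

lemma bracket_R3_move:
  assumes "framed_4_graph G" "framed_4_graph G'" "R3_move G u v w G'"
    and "even (card ({u, v, w} - W))" "W \<subseteq> verts G"
  shows "bracket G' W = bracket G W"
proof -
  obtain a1 a2 b1 b2 c1 c2 A1 A2 B1 B2 C1 C2 f
    where t: "triangle G u v w a1 a2 b1 b2 c1 c2 A1 A2 B1 B2 C1 C2"
      and f: "framed_iso (triangle.flipped G A1 A2 B1 B2 C1 C2) G' f id"
    using R3_move_flipped[OF assms(1,3)] by metis
  interpret triangle G u v w a1 a2 b1 b2 c1 c2 A1 A2 B1 B2 C1 C2 by (rule t)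
  show ?thesis
    using bracket_iso[OF framed_flipped assms(2) f, of W] assms(5) bracket_flipped_Un[OF assms(4)]
    by (simp add: verts_flipped)
qed

text \<open>\<open>free_link_equiv\<close> allows arbitrary framed 4-graphs as intermediate stages;
  by this invariance a chain starting at a knot graph consists of knot graphs, where the parity
  axioms apply.\<close>

lemma num_unicursal_Reidemeister_step:
  assumes "Reidemeister_step G G'"
  shows "num_unicursal G' = num_unicursal G"
proof -
  have F: "framed_4_graph G" "framed_4_graph G'" using assms by (auto simp: Reidemeister_step_def)
  consider (iso) f g where "framed_iso G G' f g" | (R1) v where "R1_removal G v G'"
    | (R2) u v where "R2_removal G u v G'" | (R3) u v w where "R3_move G u v w G'"
    using assms by (auto simp: Reidemeister_step_def)
  then show ?thesis
  proof cases
    case iso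
    then show ?thesis by (rule num_unicursal_iso[OF F])
  next
    case R1
    then show ?thesis by (simp add: R1_removal_def num_unicursal_splice_opp[OF F(1)])
  next
    case R2
    then show ?thesis by (simp add: R2_removal_def num_unicursal_splice_opp[OF F(1)])
  next
    case R3
    then obtain a1 a2 b1 b2 c1 c2 A1 A2 B1 B2 C1 C2 f
      where t: "triangle G u v w a1 a2 b1 b2 c1 c2 A1 A2 B1 B2 C1 C2"
        and f: "framed_iso (triangle.flipped G A1 A2 B1 B2 C1 C2) G' f id"
      using R3_move_flipped[OF F(1)] by metis
    interpret triangle G u v w a1 a2 b1 b2 c1 c2 A1 A2 B1 B2 C1 C2 by (rule t)
    show ?thesis using num_unicursal_iso[OF framed_flipped F(2) f] num_unicursal_flipped by simp
  qed
qed

lemma parity_bracket_Reidemeister_step: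
  assumes "parity P" "framed_knot_graph G" "framed_knot_graph G'" "Reidemeister_step G G'"
  shows "parity_bracket P G' = parity_bracket P G"
proof -
  have F: "framed_4_graph G" "framed_4_graph G'" using assms(4) by (auto simp: Reidemeister_step_def)
  define W W' where "W = {x \<in> verts G. P G x}" and "W' = {x \<in> verts G'. P G' x}"
  have PB: "parity_bracket P G = bracket G W" "parity_bracket P G' = bracket G' W'"
    using parity_bracket_eq_bracket F by (simp_all add: W_def W'_def)
  note P = assms(1)[unfolded parity_def, rule_format, OF conjI[OF assms(2,3)]]
  consider (iso) f g where "framed_iso G G' f g" | (R1) v where "R1_removal G v G'"
    | (R2) u v where "R2_removal G u v G'" | (R3) u v w where "R3_move G u v w G'"
    using assms(4) by (auto simp: Reidemeister_step_def)
  then show ?thesis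
  proof cases
    case iso
    have "W' = g ` W"
      unfolding W_def W'_def using framed_isoD(3)[OF iso] P iso by auto
    moreover have "W \<subseteq> verts G" by (auto simp: W_def)
    ultimately show ?thesis unfolding PB using bracket_iso[OF F iso] by simp
  next
    case R1
    then have "P G v" "\<forall>x\<in>verts G'. P G' x = P G x" using P by blast+
    moreover have "verts G' = verts G - {v}" "v \<in> verts G"
      using R1 verts_splice by (auto simp: R1_removal_def verts_def)
    ultimately have "W = W' \<union> {v}" "v \<notin> W'" by (auto simp: W_def W'_def)
    then show ?thesis unfolding PB using bracket_R1_removal[OF F(1) R1] by simp
  next
    case R2
    then have p: "P G u = P G v" "\<forall>x\<in>verts G'. P G' x = P G x" using P by blast+
    have v: "verts G' = verts G - {u, v}"
      using R2 verts_splice by (auto simp: R2_removal_def)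
    have uv: "u \<in> verts G" "v \<in> verts G"
      using R2 framed_4_graphD(8)[OF F(1)] by (auto simp: R2_removal_def verts_def)
    have out: "u \<notin> W'" "v \<notin> W'" using v by (auto simp: W'_def)
    show ?thesis
    proof (cases "P G u")
      case True
      then have "W = W' \<union> {u, v}" using p v uv by (auto simp: W_def W'_def)
      then show ?thesis unfolding PB using bracket_R2_removal(1)[OF F(1) R2 out] by simp
    next
      case False
      then have "W = W'" using p v uv by (auto simp: W_def W'_def)
      then show ?thesis unfolding PB using bracket_R2_removal(2)[OF F(1) R2 out] by simp
    qed
  next
    case R3
    then have p: "even (card {x \<in> {u, v, w}. \<not> P G x})" "\<forall>x\<in>verts G. P G' x = P G x" using P by blast+
    have v: "verts G' = verts G" using R3 by (auto simp: R3_move_def verts_def Let_def)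
    have "{u, v, w} \<subseteq> verts G"
      using R3 by (auto simp: R3_move_def verts_def)
    then have "{u, v, w} - W = {x \<in> {u, v, w}. \<not> P G x}" by (auto simp: W_def)
    moreover have "W' = W" using v p by (auto simp: W_def W'_def)
    moreover have "W \<subseteq> verts G" by (auto simp: W_def)
    ultimately show ?thesis unfolding PB using bracket_R3_move[OF F R3, of W] p(1) by simp
  qed
qed

theorem theorem4:
  fixes P :: "framed_graph \<Rightarrow> nat \<Rightarrow> bool" and \<Gamma> \<Gamma>' :: framed_graph
  assumes "parity P"
    and "framed_knot_graph \<Gamma>" and "framed_knot_graph \<Gamma>'"
    and "free_link_equiv \<Gamma> \<Gamma>'"
  shows "parity_bracket P \<Gamma> = parity_bracket P \<Gamma>'"
proof -
  \<comment> \<open>An equivalence is needed, because a chain may use steps in either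
    direction.\<close>
  have "framed_knot_graph G \<longleftrightarrow> framed_knot_graph G'" if "Reidemeister_step G G'" for G G'
    using num_unicursal_Reidemeister_step[OF that] that
    by (auto simp: framed_knot_graph_def Reidemeister_step_def)
  moreover have "equivclp Reidemeister_step \<Gamma> \<Gamma>'"
    using assms(4) by (simp add: free_link_equiv_def)
  then have "framed_knot_graph \<Gamma>' \<and> parity_bracket P \<Gamma> = parity_bracket P \<Gamma>'"
  proof (induction rule: equivclp_induct)
    case base
    show ?case using assms(2) by simp
  next
    case (step G G')
    then show ?case
      using calculation parity_bracket_Reidemeister_step[OF assms(1)] by metis
  qed
  then show ?thesis by simp
qed

end
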